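(* Let $w\in L_{\mathrm{Shi}}$ and let $\mathcal R$ be the Shi region containing $w\cdot A_\circ$. Then $ND_R(w)=\Sigma D(\mathcal R)$.
   Context: Let $V_0$ be a Euclidean space with inner product $\langle\cdot,\cdot\rangle$ and $\Phi_0\subset V_0$ an irreducible crystallographic root system with simple system $\Delta_0$, positive system $\Phi_0^+$ and highest root $\alpha_0$. For $\alpha\in\Phi_0$ set $\alpha^\vee=2\alpha/\langle\alpha,\alpha\rangle$, and for $k\in\mathbb Z$ let $H_{\alpha,k}=\{x\in V_0:\langle x,\alpha\rangle=k\}$ and $s_{\alpha,k}(x)=x-(\langle\alpha,x\rangle-k)\alpha^\vee$; $s_\alpha=s_{\alpha,0}$. Let $S_0=\{s_\alpha:\alpha\in\Delta_0\}$, $W$ the affine Weyl group generated by all $s_{\alpha,k}$, $S=S_0\cup\{s_{\alpha_0,1}\}$, with length $\ell$. $A_\circ=\{x:\langle x,\alpha\rangle>0\ \forall\alpha\in\Delta_0,\ \langle x,\alpha_0\rangle<1\}$ is the fundamental alcove; $w\mapsto w\cdot A_\circ$ is a bijection from $W$ onto the alcoves (components of $V_0\setminus\bigcup H_{\alpha,k}$). Roots: in $V=V_0\oplus\mathbb R\delta$, $\Phi^+=\{\alpha+k\delta:\alpha\in\Phi_0^+,k\ge0\}\sqcup\{\alpha+k\delta:\alpha\in-\Phi_0^+,k\ge1\}$, $\Phi=\Phi^+\sqcup(-\Phi^+)$. To $\gamma=\alpha+k\delta\in\Phi^+$ are attached the reflection $s_{-\alpha,k}$ and the hyperplane $H_\gamma=H_{-\alpha,k}$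 (so $H_{\alpha}=H_{\alpha,0}$ and $H_{\delta-\alpha}=H_{\alpha,1}$ for $\alpha\in\Phi_0^+$). $W$ acts linearly on $V$, the reflection attached to $\alpha+k\delta$ acting by $x_0+a\delta\mapsto s_\alpha(x_0)+(a-k\langle\alpha^\vee,x_0\rangle)\delta$. Simple roots: $\Delta=\Delta_0\sqcup\{\delta-\alpha_0\}$; for $s\in S$, $\alpha_s\in\Delta$ is its simple root. $N(w)=\Phi^+\cap w(-\Phi^+)$ is the set of $\gamma\in\Phi^+$ with $H_\gamma$ separating $A_\circ$ from $w\cdot A_\circ$. Small roots $\Sigma=\Phi_0^+\sqcup\{\delta-\alpha:\alpha\in\Phi_0^+\}$. The Shi arrangement is $\{H_\beta:\beta\in\Sigma\}$; Shi regions are the connected components of $V_0$ minus the union of these hyperplanes; $u\sim v$ iff $u\cdot A_\circ,v\cdot A_\circ$ lie in the same Shi region; $L_{\mathrm{Shi}}$ is the set of $w$ with $\ell(w)\le\ell(u)$ for all $u\sim w$. For a Shi region $\mathcal R$, $\Sigma(\mathcal R)=\{\beta\in\Sigma:H_\beta$ separates $\mathcal R$ from $A_\circ\}$. A hyperplane $H$ of the Shi arrangement is a wall of $\mathcal R$ if it supports a facet of $\mathcal R$; it is a descent-wall if moreover it separates $\mathcal R$ from $A_\circ$; $\Sigma D(\mathcal R)=\{\beta\in\Sigma(\mathcal R):H_\beta$ is a descent-wall of $\mathcal R\}$. $D_R(w)=\{s\in S:\ell(ws)<\ell(w)\}$ and $ND_R(w)=\{-w(\alpha_s):s\in D_R(w)\}$.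 *)

theory Defs
  imports "HOL-Analysis.Analysis"
begin

section \<open>Finite root systems\<close>

definition coroot :: "'a::euclidean_space \<Rightarrow> 'a" where
  "coroot \<alpha> = (2 / (\<alpha> \<bullet> \<alpha>)) *\<^sub>R \<alpha>"

definition hyp :: "'a::euclidean_space \<Rightarrow> real \<Rightarrow> 'a set" where
  "hyp \<alpha> k = {x. x \<bullet> \<alpha> = k}"

definition refl_aff :: "'a::euclidean_space \<Rightarrow> real \<Rightarrow> 'a \<Rightarrow> 'a" where
  "refl_aff \<alpha> k x = x - (\<alpha> \<bullet> x - k) *\<^sub>R coroot \<alpha>"

abbreviation refl_lin :: "'a::euclidean_space \<Rightarrow> 'a \<Rightarrow> 'a" where
  "refl_lin \<alpha> \<equiv> refl_aff \<alpha> 0"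

text \<open>Root systems are reduced and span the ambient space.\<close>

definition crystallographic_root_system :: "'a::euclidean_space set \<Rightarrow> bool" where
  "crystallographic_root_system \<Phi>0 \<longleftrightarrow>
     finite \<Phi>0 \<and> 0 \<notin> \<Phi>0 \<and> span \<Phi>0 = UNIV \<and>
     (\<forall>\<alpha>\<in>\<Phi>0. \<forall>c. c *\<^sub>R \<alpha> \<in> \<Phi>0 \<longleftrightarrow> c = 1 \<or> c = -1) \<and>
     (\<forall>\<alpha>\<in>\<Phi>0. refl_lin \<alpha> ` \<Phi>0 = \<Phi>0) \<and>
     (\<forall>\<alpha>\<in>\<Phi>0. \<forall>\<beta>\<in>\<Phi>0. \<beta> \<bullet> coroot \<alpha> \<in> \<int>)"

definition irreducible_root_system :: "'a::euclidean_space set \<Rightarrow> bool" where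
  "irreducible_root_system \<Phi>0 \<longleftrightarrow>
     \<Phi>0 \<noteq> {} \<and>
     \<not> (\<exists>A B. A \<noteq> {} \<and> B \<noteq> {} \<and> A \<union> B = \<Phi>0 \<and> A \<inter> B = {} \<and>
              (\<forall>\<alpha>\<in>A. \<forall>\<beta>\<in>B. \<alpha> \<bullet> \<beta> = 0))"

definition nonneg_comb :: "'a::euclidean_space set \<Rightarrow> 'a set" where
  "nonneg_comb D = {\<Sum>\<alpha>\<in>D. c \<alpha> *\<^sub>R \<alpha> | c. \<forall>\<alpha>\<in>D. 0 \<le> c \<alpha>}"

definition simple_system :: "'a::euclidean_space set \<Rightarrow> 'a set \<Rightarrow> bool" where
  "simple_system \<Phi>0 \<Delta>0 \<longleftrightarrow>
     \<Delta>0 \<subseteq> \<Phi>0 \<and> independent \<Delta>0 \<and> span \<Delta>0 = span \<Phi>0 \<and>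
     (\<forall>\<alpha>\<in>\<Phi>0. \<alpha> \<in> nonneg_comb \<Delta>0 \<or> - \<alpha> \<in> nonneg_comb \<Delta>0)"

definition fin_pos_roots :: "'a::euclidean_space set \<Rightarrow> 'a set \<Rightarrow> 'a set" where
  "fin_pos_roots \<Phi>0 \<Delta>0 = \<Phi>0 \<inter> nonneg_comb \<Delta>0"

definition highest_root :: "'a::euclidean_space set \<Rightarrow> 'a set \<Rightarrow> 'a \<Rightarrow> bool" where
  "highest_root \<Phi>0 \<Delta>0 \<alpha>0 \<longleftrightarrow>
     \<alpha>0 \<in> \<Phi>0 \<and> (\<forall>\<beta>\<in>\<Phi>0. \<alpha>0 - \<beta> \<in> nonneg_comb \<Delta>0)"


section \<open>Affine roots\<close>

text \<open>The space \<open>V = V\<^sub>0 \<oplus> \<real>\<delta>\<close> is the product type \<^typ>\<open>'a \<times> real\<close>;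
  the pair \<open>(\<alpha>, k)\<close> stands for \<open>\<alpha> + k\<delta>\<close>.\<close>

definition pos_roots :: "'a::euclidean_space set \<Rightarrow> 'a set \<Rightarrow> ('a \<times> real) set" where
  "pos_roots \<Phi>0 \<Delta>0 =
     {(\<alpha>, of_int k) | \<alpha> (k::int). \<alpha> \<in> fin_pos_roots \<Phi>0 \<Delta>0 \<and> 0 \<le> k} \<union>
     {(- \<alpha>, of_int k) | \<alpha> (k::int). \<alpha> \<in> fin_pos_roots \<Phi>0 \<Delta>0 \<and> 1 \<le> k}"

definition simple_roots :: "'a::euclidean_space set \<Rightarrow> 'a \<Rightarrow> ('a \<times> real) set" where
  "simple_roots \<Delta>0 \<alpha>0 = {(\<alpha>, 0) | \<alpha>. \<alpha> \<in> \<Delta>0} \<union> {(- \<alpha>0, 1)}"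

definition small_roots :: "'a::euclidean_space set \<Rightarrow> 'a set \<Rightarrow> ('a \<times> real) set" where
  "small_roots \<Phi>0 \<Delta>0 =
     {(\<alpha>, 0) | \<alpha>. \<alpha> \<in> fin_pos_roots \<Phi>0 \<Delta>0} \<union>
     {(- \<alpha>, 1) | \<alpha>. \<alpha> \<in> fin_pos_roots \<Phi>0 \<Delta>0}"

text \<open>Note the sign: the hyperplane and reflection of \<open>\<alpha> + k\<delta>\<close>
  are \<open>H\<close> and \<open>s\<close> with index \<open>(-\<alpha>, k)\<close>.\<close>

definition root_hyp :: "'a::euclidean_space \<times> real \<Rightarrow> 'a set" where
  "root_hyp \<gamma> = hyp (- fst \<gamma>) (snd \<gamma>)"

definition root_refl :: "'a::euclidean_space \<times> real \<Rightarrow> 'a \<Rightarrow> 'a" where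
  "root_refl \<gamma> = refl_aff (- fst \<gamma>) (snd \<gamma>)"

definition root_refl_V :: "'a::euclidean_space \<times> real \<Rightarrow> 'a \<times> real \<Rightarrow> 'a \<times> real" where
  "root_refl_V \<gamma> v =
     (refl_lin (fst \<gamma>) (fst v), snd v - snd \<gamma> * (coroot (fst \<gamma>) \<bullet> fst v))"


section \<open>The affine Weyl group\<close>

text \<open>Closure under inverses is automatic, since the generators are involutions.\<close>

inductive_set affine_weyl :: "'a::euclidean_space set \<Rightarrow> ('a \<Rightarrow> 'a) set"
  for \<Phi>0 :: "'a set" where
  affine_weyl_id: "id \<in> affine_weyl \<Phi>0"
| affine_weyl_refl: "\<alpha> \<in> \<Phi>0 \<Longrightarrow> w \<in> affine_weyl \<Phi>0 \<Longrightarrow>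
     refl_aff \<alpha> (of_int (k::int)) \<circ> w \<in> affine_weyl \<Phi>0"

definition simple_refls :: "'a::euclidean_space set \<Rightarrow> 'a \<Rightarrow> ('a \<Rightarrow> 'a) set" where
  "simple_refls \<Delta>0 \<alpha>0 = refl_lin ` \<Delta>0 \<union> {refl_aff \<alpha>0 1}"

definition len :: "'a::euclidean_space set \<Rightarrow> 'a \<Rightarrow> ('a \<Rightarrow> 'a) \<Rightarrow> nat" where
  "len \<Delta>0 \<alpha>0 w =
     (LEAST n. \<exists>ss. set ss \<subseteq> simple_refls \<Delta>0 \<alpha>0 \<and> length ss = n \<and> foldr (\<circ>) ss id = w)"

text \<open>The linear action of \<open>W\<close> on \<open>V\<close> is specified on the reflections. The relation
  \<open>acts_as w g\<close> says that some product of reflections equal to \<open>w\<close> acts on \<open>V\<close> as \<open>g\<close>;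
  it is functional on \<open>W\<close> by \<open>acts_as_unique\<close> and \<open>acts_as_total\<close> below.\<close>

inductive acts_as :: "'a::euclidean_space set \<Rightarrow> 'a set \<Rightarrow>
    ('a \<Rightarrow> 'a) \<Rightarrow> ('a \<times> real \<Rightarrow> 'a \<times> real) \<Rightarrow> bool"
  for \<Phi>0 \<Delta>0 :: "'a set" where
  acts_as_id: "acts_as \<Phi>0 \<Delta>0 id id"
| acts_as_refl: "\<gamma> \<in> pos_roots \<Phi>0 \<Delta>0 \<Longrightarrow> acts_as \<Phi>0 \<Delta>0 w g \<Longrightarrow>
     acts_as \<Phi>0 \<Delta>0 (root_refl \<gamma> \<circ> w) (root_refl_V \<gamma> \<circ> g)"

definition act :: "'a::euclidean_space set \<Rightarrow> 'a set \<Rightarrow> ('a \<Rightarrow> 'a) \<Rightarrow> 'a \<times> real \<Rightarrow> 'a \<times> real" where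
  "act \<Phi>0 \<Delta>0 w = (THE g. acts_as \<Phi>0 \<Delta>0 w g)"

definition simple_root_of :: "'a::euclidean_space set \<Rightarrow> 'a \<Rightarrow> ('a \<Rightarrow> 'a) \<Rightarrow> 'a \<times> real" where
  "simple_root_of \<Delta>0 \<alpha>0 s = (THE \<gamma>. \<gamma> \<in> simple_roots \<Delta>0 \<alpha>0 \<and> root_refl \<gamma> = s)"

definition right_descents :: "'a::euclidean_space set \<Rightarrow> 'a \<Rightarrow> ('a \<Rightarrow> 'a) \<Rightarrow> ('a \<Rightarrow> 'a) set" where
  "right_descents \<Delta>0 \<alpha>0 w =
     {s \<in> simple_refls \<Delta>0 \<alpha>0. len \<Delta>0 \<alpha>0 (w \<circ> s) < len \<Delta>0 \<alpha>0 w}"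

definition ND_R :: "'a::euclidean_space set \<Rightarrow> 'a set \<Rightarrow> 'a \<Rightarrow> ('a \<Rightarrow> 'a) \<Rightarrow> ('a \<times> real) set" where
  "ND_R \<Phi>0 \<Delta>0 \<alpha>0 w =
     {- act \<Phi>0 \<Delta>0 w (simple_root_of \<Delta>0 \<alpha>0 s) | s. s \<in> right_descents \<Delta>0 \<alpha>0 w}"


section \<open>The Shi arrangement\<close>

definition fund_alcove :: "'a::euclidean_space set \<Rightarrow> 'a \<Rightarrow> 'a set" where
  "fund_alcove \<Delta>0 \<alpha>0 = {x. (\<forall>\<alpha>\<in>\<Delta>0. 0 < x \<bullet> \<alpha>) \<and> x \<bullet> \<alpha>0 < 1}"

definition shi_regions :: "'a::euclidean_space set \<Rightarrow> 'a set \<Rightarrow> 'a set set" where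
  "shi_regions \<Phi>0 \<Delta>0 = components (UNIV - (\<Union>\<beta>\<in>small_roots \<Phi>0 \<Delta>0. root_hyp \<beta>))"

definition shi_equiv ::
    "'a::euclidean_space set \<Rightarrow> 'a set \<Rightarrow> 'a \<Rightarrow> ('a \<Rightarrow> 'a) \<Rightarrow> ('a \<Rightarrow> 'a) \<Rightarrow> bool" where
  "shi_equiv \<Phi>0 \<Delta>0 \<alpha>0 u v \<longleftrightarrow>
     (\<exists>R\<in>shi_regions \<Phi>0 \<Delta>0. u ` fund_alcove \<Delta>0 \<alpha>0 \<subseteq> R \<and> v ` fund_alcove \<Delta>0 \<alpha>0 \<subseteq> R)"

definition L_Shi :: "'a::euclidean_space set \<Rightarrow> 'a set \<Rightarrow> 'a \<Rightarrow> ('a \<Rightarrow> 'a) set" where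
  "L_Shi \<Phi>0 \<Delta>0 \<alpha>0 =
     {w \<in> affine_weyl \<Phi>0.
        \<forall>u\<in>affine_weyl \<Phi>0. shi_equiv \<Phi>0 \<Delta>0 \<alpha>0 u w \<longrightarrow> len \<Delta>0 \<alpha>0 w \<le> len \<Delta>0 \<alpha>0 u}"

text \<open>Opposite open half-spaces; either order of \<open>X\<close> and \<open>Y\<close> is covered by negating \<open>a\<close> and \<open>b\<close>.\<close>

definition separates :: "'a::euclidean_space set \<Rightarrow> 'a set \<Rightarrow> 'a set \<Rightarrow> bool" where
  "separates H X Y \<longleftrightarrow>
     (\<exists>a b. a \<noteq> 0 \<and> H = {x. a \<bullet> x = b} \<and> (\<forall>x\<in>X. a \<bullet> x < b) \<and> (\<forall>y\<in>Y. b < a \<bullet> y))"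

definition wall :: "'a::euclidean_space set \<Rightarrow> 'a set \<Rightarrow> 'a set \<Rightarrow> 'a set \<Rightarrow> bool" where
  "wall \<Phi>0 \<Delta>0 R H \<longleftrightarrow>
     H \<in> root_hyp ` small_roots \<Phi>0 \<Delta>0 \<and> (\<exists>F. F facet_of closure R \<and> affine hull F = H)"

definition descent_wall ::
    "'a::euclidean_space set \<Rightarrow> 'a set \<Rightarrow> 'a \<Rightarrow> 'a set \<Rightarrow> 'a set \<Rightarrow> bool" where
  "descent_wall \<Phi>0 \<Delta>0 \<alpha>0 R H \<longleftrightarrow> wall \<Phi>0 \<Delta>0 R H \<and> separates H R (fund_alcove \<Delta>0 \<alpha>0)"

definition Sigma_region ::
    "'a::euclidean_space set \<Rightarrow> 'a set \<Rightarrow> 'a \<Rightarrow> 'a set \<Rightarrow> ('a \<times> real) set" where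
  "Sigma_region \<Phi>0 \<Delta>0 \<alpha>0 R =
     {\<beta> \<in> small_roots \<Phi>0 \<Delta>0. separates (root_hyp \<beta>) R (fund_alcove \<Delta>0 \<alpha>0)}"

definition SigmaD ::
    "'a::euclidean_space set \<Rightarrow> 'a set \<Rightarrow> 'a \<Rightarrow> 'a set \<Rightarrow> ('a \<times> real) set" where
  "SigmaD \<Phi>0 \<Delta>0 \<alpha>0 R =
     {\<beta> \<in> Sigma_region \<Phi>0 \<Delta>0 \<alpha>0 R. descent_wall \<Phi>0 \<Delta>0 \<alpha>0 R (root_hyp \<beta>)}"


section \<open>Well-definedness of the action and of the simple root of a reflection\<close>

lemma coroot_uminus: "coroot (- \<alpha>) = - coroot \<alpha>"
  by (simp add: coroot_def)

lemma refl_aff_uminus: "refl_aff (- \<alpha>) k = refl_aff \<alpha> (- k)"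
  by (rule ext) (simp add: refl_aff_def coroot_uminus algebra_simps)

lemma refl_aff_invol:
  assumes "\<alpha> \<noteq> 0" shows "refl_aff \<alpha> k (refl_aff \<alpha> k x) = x"
proof -
  have "\<alpha> \<bullet> coroot \<alpha> = 2" using assms by (simp add: coroot_def)
  then have r: "\<alpha> \<bullet> refl_aff \<alpha> k x - k = - (\<alpha> \<bullet> x - k)"
    by (simp add: refl_aff_def inner_diff_right algebra_simps)
  have "refl_aff \<alpha> k (refl_aff \<alpha> k x)
      = refl_aff \<alpha> k x - (\<alpha> \<bullet> refl_aff \<alpha> k x - k) *\<^sub>R coroot \<alpha>"
    by (rule refl_aff_def)
  also have "\<dots> = refl_aff \<alpha> k x + (\<alpha> \<bullet> x - k) *\<^sub>R coroot \<alpha>"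
    by (simp only: r scaleR_minus_left diff_minus_eq_add)
  also have "\<dots> = x" by (simp add: refl_aff_def)
  finally show ?thesis .
qed

lemma pos_roots_fst:
  assumes "crystallographic_root_system \<Phi>0" "\<gamma> \<in> pos_roots \<Phi>0 \<Delta>0"
  shows "fst \<gamma> \<noteq> 0"
  using assms by (auto simp: pos_roots_def fin_pos_roots_def crystallographic_root_system_def)

text \<open>Viewing \<open>x\<^sub>0 + a\<delta>\<close> as the affine function \<open>y \<mapsto> \<langle>x\<^sub>0, y\<rangle> + a\<close>, the group acts by
  composition with the inverse.\<close>

lemma root_refl_V_pairing:
  assumes "fst \<gamma> \<noteq> 0"
  shows "fst (root_refl_V \<gamma> v) \<bullet> root_refl \<gamma> y + snd (root_refl_V \<gamma> v) = fst v \<bullet> y + snd v"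
proof -
  obtain \<alpha> k where g: "\<gamma> = (\<alpha>, k)" by (cases \<gamma>)
  define t where "t = 2 / (\<alpha> \<bullet> \<alpha>)"
  have t: "t * (\<alpha> \<bullet> \<alpha>) = 2" using assms g by (simp add: t_def)
  have r: "fst (root_refl_V \<gamma> v) = fst v - ((\<alpha> \<bullet> fst v) * t) *\<^sub>R \<alpha>"
    "snd (root_refl_V \<gamma> v) = snd v - k * (t * (\<alpha> \<bullet> fst v))"
    "root_refl \<gamma> y = y - ((\<alpha> \<bullet> y + k) * t) *\<^sub>R \<alpha>"
    by (simp_all add: g root_refl_V_def root_refl_def refl_aff_uminus refl_aff_def coroot_def t_def)
  have "fst (root_refl_V \<gamma> v) \<bullet> root_refl \<gamma> y + snd (root_refl_V \<gamma> v)
     = fst v \<bullet> y + snd v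
       + (t * (\<alpha> \<bullet> \<alpha>) - 2) * (t * ((\<alpha> \<bullet> fst v) * (\<alpha> \<bullet> y + k)))"
    unfolding r by (simp add: inner_diff_left inner_diff_right inner_commute algebra_simps)
  then show ?thesis by (simp add: t)
qed

lemma acts_as_pairing:
  assumes "crystallographic_root_system \<Phi>0" "acts_as \<Phi>0 \<Delta>0 w g"
  shows "surj w \<and> (\<forall>v y. fst (g v) \<bullet> w y + snd (g v) = fst v \<bullet> y + snd v)"
  using assms(2)
proof induction
  case acts_as_id
  then show ?case by simp
next
  case (acts_as_refl \<gamma> w g)
  have n: "fst \<gamma> \<noteq> 0" using pos_roots_fst[OF assms(1) acts_as_refl.hyps(1)] .
  have "surj (root_refl \<gamma>)"
    by (rule surjI[where f = "root_refl \<gamma>"]) (use n in \<open>simp add: root_refl_def refl_aff_invol\<close>)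
  then have "surj (root_refl \<gamma> \<circ> w)"
    using acts_as_refl.IH by (intro comp_surj) auto
  then show ?case using acts_as_refl.IH root_refl_V_pairing[OF n] by auto
qed

lemma acts_as_unique:
  assumes \<Phi>0: "crystallographic_root_system \<Phi>0"
    and g: "acts_as \<Phi>0 \<Delta>0 w g" and h: "acts_as \<Phi>0 \<Delta>0 w h"
  shows "g = h"
proof
  fix v
  have eq: "fst (g v) \<bullet> z + snd (g v) = fst (h v) \<bullet> z + snd (h v)" for z
    using acts_as_pairing[OF \<Phi>0 g] acts_as_pairing[OF \<Phi>0 h] by (metis surjD)
  have s: "snd (g v) = snd (h v)" using eq[of 0] by simp
  then have "fst (g v) \<bullet> z = fst (h v) \<bullet> z" for z using eq[of z] by simp
  then have "fst (g v) = fst (h v)" using vector_eq_rdot by blast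
  with s show "g v = h v" by (simp add: prod_eq_iff)
qed

lemma refl_aff_eq_root_refl:
  assumes \<Phi>0: "crystallographic_root_system \<Phi>0" and \<Delta>0: "simple_system \<Phi>0 \<Delta>0"
    and \<alpha>: "\<alpha> \<in> \<Phi>0"
  shows "\<exists>\<gamma>\<in>pos_roots \<Phi>0 \<Delta>0. root_refl \<gamma> = refl_aff \<alpha> (of_int k)"
proof -
  have neg: "- \<beta> \<in> \<Phi>0" if "\<beta> \<in> \<Phi>0" for \<beta>
  proof -
    have "(-1) *\<^sub>R \<beta> \<in> \<Phi>0"
      using \<Phi>0 that unfolding crystallographic_root_system_def by blast
    then show ?thesis by simp
  qed
  have pos: "\<exists>\<gamma>\<in>pos_roots \<Phi>0 \<Delta>0. root_refl \<gamma> = refl_aff \<beta> (of_int j)"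
    if \<beta>: "\<beta> \<in> fin_pos_roots \<Phi>0 \<Delta>0" for \<beta> j
  proof (cases "j \<ge> 1")
    case True
    then have "(- \<beta>, of_int j) \<in> pos_roots \<Phi>0 \<Delta>0" using \<beta> by (auto simp: pos_roots_def)
    moreover have "root_refl (- \<beta>, of_int j) = refl_aff \<beta> (of_int j)"
      by (simp add: root_refl_def)
    ultimately show ?thesis by blast
  next
    case False
    then have "(\<beta>, of_int (- j)) \<in> pos_roots \<Phi>0 \<Delta>0"
      unfolding pos_roots_def
      by (intro UnI1 CollectI exI[of _ \<beta>] exI[of _ "- j"]) (use False \<beta> in auto)
    moreover have "root_refl (\<beta>, of_int (- j)) = refl_aff \<beta> (of_int j)"
      by (simp add: root_refl_def refl_aff_uminus)
    ultimately show ?thesis by blast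
  qed
  consider "\<alpha> \<in> fin_pos_roots \<Phi>0 \<Delta>0" | "- \<alpha> \<in> fin_pos_roots \<Phi>0 \<Delta>0"
    using \<Delta>0 \<alpha> neg[OF \<alpha>] by (auto simp: simple_system_def fin_pos_roots_def)
  then show ?thesis
  proof cases
    case 1
    then show ?thesis by (rule pos)
  next
    case 2
    then show ?thesis using pos[of "- \<alpha>" "- k"] by (simp add: refl_aff_uminus)
  qed
qed

lemma acts_as_total:
  assumes "crystallographic_root_system \<Phi>0" "simple_system \<Phi>0 \<Delta>0" "w \<in> affine_weyl \<Phi>0"
  shows "\<exists>!g. acts_as \<Phi>0 \<Delta>0 w g"
proof -
  have "\<exists>g. acts_as \<Phi>0 \<Delta>0 w g" using assms(3)
  proof induction
    case affine_weyl_id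
    then show ?case using acts_as_id by blast
  next
    case (affine_weyl_refl \<alpha> w k)
    then show ?case using refl_aff_eq_root_refl[OF assms(1,2)] acts_as_refl by metis
  qed
  then show ?thesis using acts_as_unique[OF assms(1)] by blast
qed

lemma simple_root_of_unique:
  assumes \<Phi>0: "crystallographic_root_system \<Phi>0" and \<Delta>0: "simple_system \<Phi>0 \<Delta>0"
    and \<alpha>0: "highest_root \<Phi>0 \<Delta>0 \<alpha>0" and s: "s \<in> simple_refls \<Delta>0 \<alpha>0"
  shows "\<exists>!\<gamma>. \<gamma> \<in> simple_roots \<Delta>0 \<alpha>0 \<and> root_refl \<gamma> = s"
proof -
  have ex: "\<exists>\<gamma>. \<gamma> \<in> simple_roots \<Delta>0 \<alpha>0 \<and> root_refl \<gamma> = s"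
  proof (cases "s = refl_aff \<alpha>0 1")
    case True
    then show ?thesis
      by (intro exI[of _ "(- \<alpha>0, 1)"]) (simp add: simple_roots_def root_refl_def)
  next
    case False
    then obtain \<alpha> where "\<alpha> \<in> \<Delta>0" "s = refl_lin \<alpha>" using s by (auto simp: simple_refls_def)
    then show ?thesis
      by (intro exI[of _ "(\<alpha>, 0)"]) (simp add: simple_roots_def root_refl_def refl_aff_uminus)
  qed
  have \<alpha>0n: "\<alpha>0 \<noteq> 0"
    using \<alpha>0 \<Phi>0 by (auto simp: highest_root_def crystallographic_root_system_def)
  have ne: "refl_aff \<alpha>0 1 \<noteq> refl_lin \<alpha>" for \<alpha>
  proof
    assume "refl_aff \<alpha>0 1 = refl_lin \<alpha>"
    then have "refl_aff \<alpha>0 1 0 = refl_lin \<alpha> 0" by simp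
    then show False using \<alpha>0n by (simp add: refl_aff_def coroot_def)
  qed
  have inj: "\<alpha> = \<beta>" if "\<alpha> \<in> \<Delta>0" "\<beta> \<in> \<Delta>0" "refl_lin \<alpha> = refl_lin \<beta>" for \<alpha> \<beta>
  proof (rule ccontr)
    assume ab: "\<alpha> \<noteq> \<beta>"
    have "\<alpha> \<noteq> 0"
      using that(1) \<Delta>0 \<Phi>0 by (auto simp: simple_system_def crystallographic_root_system_def)
    then have "refl_lin \<alpha> \<alpha> = - \<alpha>"
      by (simp add: refl_aff_def coroot_def scaleR_2)
    then have "refl_lin \<beta> \<alpha> = - \<alpha>" using that(3) by simp
    then have "2 *\<^sub>R \<alpha> = (\<beta> \<bullet> \<alpha>) *\<^sub>R coroot \<beta>"
      by (simp add: refl_aff_def scaleR_2 algebra_simps)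
    then have "(1/2) *\<^sub>R (2 *\<^sub>R \<alpha>) = ((\<beta> \<bullet> \<alpha>) / (\<beta> \<bullet> \<beta>)) *\<^sub>R \<beta>" by (simp add: coroot_def)
    then have "\<alpha> \<in> span {\<beta>}" by (simp add: span_singleton)
    moreover have "span {\<beta>} \<subseteq> span (\<Delta>0 - {\<alpha>})" using that(2) ab by (intro span_mono) auto
    ultimately have "dependent \<Delta>0" using that(1) by (auto simp: dependent_def)
    then show False using \<Delta>0 by (simp add: simple_system_def)
  qed
  have "\<gamma> = \<gamma>'" if "\<gamma> \<in> simple_roots \<Delta>0 \<alpha>0" "\<gamma>' \<in> simple_roots \<Delta>0 \<alpha>0"
    "root_refl \<gamma> = root_refl \<gamma>'" for \<gamma> \<gamma>'
    using that inj ne ne[symmetric]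
    by (auto simp: simple_roots_def root_refl_def refl_aff_uminus)
  then show ?thesis using ex by blast
qed

end

theory Submission
  imports Defs
begin

text \<open>
  Write \<open>h = w\<^sup>-\<^sup>1\<close> acting on affine roots, so that the walls of \<open>w \<cdot> A\<close> are the roots sent by \<open>h\<close> to
  a simple root or its negative, and call a chamber locally minimal if all its descent walls are
  small. The descent walls of \<open>w \<in> L_Shi\<close> are small, since crossing a non-small one stays in the
  region and shortens \<open>w\<close>; they are walls of the region because the alcove has a facet there.

  For the converse, the roots that are not small are those above \<open>\<delta>\<close>, and \<open>a\<beta> + b\<gamma>\<close> is again not
  small when \<open>\<gamma>\<close> is not small and \<open>b \<ge> 1\<close>. Around a codimension-two face with two descent walls,
  one of them not small, one can therefore go down inside the region. As in Newman's lemma this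
  gives that a locally minimal chamber lies below all chambers of its region, and also that a small
  descent wall can be kept while going down from an arbitrary chamber to the minimal one. A chamber
  of the region having a given descent wall of the region as a wall is found on a shortest gallery
  towards the region on the other side of that wall.
\<close>

section \<open>Simple systems and their length function\<close>

text \<open>The combinatorics lives in an abstract locale: coordinates along the simple roots, a
  form required to be positive on roots only (in the affine instance \<delta> is isotropic, so
  definiteness is out of reach), and finiteness of the set of positive roots made negative by one
  reflection. The obstacle is that membership in \<open>L_Shi\<close> compares lengths and so yields
  only local information about \<open>w\<close>. Passing to a least element of the region takes a
  confluence argument, and confluence needs integral coefficients for the roots around a
  codimension-two face: a non-zero nonnegative combination of the two wall roots then has a
  coefficient at least 1, as \<open>not_small_comb\<close> demands. Integrality of all coordinates
  comes from conjugating every positive root to a simple one. No classification of rank-two systems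
  enters: that all ways down around the face meet is read off from a nonnegative matrix whose
  inverse is nonnegative as well.\<close>

lemma Ints_pos_ge1: "a \<in> \<int> \<Longrightarrow> 0 < a \<Longrightarrow> 1 \<le> (a::real)"
  by (elim Ints_cases) auto

lemma Ints_nonneg_cases: "(a::real) \<in> \<int> \<Longrightarrow> 0 \<le> a \<Longrightarrow> a = 0 \<or> 1 \<le> a"
  by (elim Ints_cases) (auto simp: order_le_less)

text \<open>Integrality is asked only between simple roots; \<open>c_int\<close> extends it to all
  roots. \<open>finite_reflect\<close> says that a single reflection has finitely many inversions,
  the input for conjugating each positive root to a simple one when the root set itself is
  infinite.\<close>

locale root_basis =
  fixes \<Phi> D :: "'v::real_vector set"
    and c B :: "'v \<Rightarrow> 'v \<Rightarrow> real"
    and \<delta> :: 'v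
  assumes finite_D: "finite D"
    and D_sub: "D \<subseteq> \<Phi>"
    and linear_c: "i \<in> D \<Longrightarrow> linear (c i)"
    and c_D: "i \<in> D \<Longrightarrow> j \<in> D \<Longrightarrow> c i j = (if i = j then 1 else 0)"
    and c_eq_0: "(\<And>i. i \<in> D \<Longrightarrow> c i v = 0) \<Longrightarrow> v = 0"
    and c_sign: "\<phi> \<in> \<Phi> \<Longrightarrow> (\<forall>i\<in>D. 0 \<le> c i \<phi>) \<or> (\<forall>i\<in>D. c i \<phi> \<le> 0)"
    and reduced: "i \<in> D \<Longrightarrow> a *\<^sub>R i \<in> \<Phi> \<Longrightarrow> a = 1 \<or> a = -1"
    and bilinear_B: "bilinear B"
    and B_commute: "B u v = B v u"
    and B_pos: "\<phi> \<in> \<Phi> \<Longrightarrow> 0 < B \<phi> \<phi>"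
    and cartan_int: "i \<in> D \<Longrightarrow> j \<in> D \<Longrightarrow> 2 * B i j / B i i \<in> \<int>"
    and root_reflect: "\<phi> \<in> \<Phi> \<Longrightarrow> \<psi> \<in> \<Phi> \<Longrightarrow> \<psi> - (2 * B \<phi> \<psi> / B \<phi> \<phi>) *\<^sub>R \<phi> \<in> \<Phi>"
    and finite_reflect: "\<phi> \<in> \<Phi> \<Longrightarrow>
      finite {\<psi> \<in> \<Phi>. (\<forall>i\<in>D. 0 \<le> c i \<psi>) \<and>
        \<not> (\<forall>i\<in>D. 0 \<le> c i (\<psi> - (2 * B \<phi> \<psi> / B \<phi> \<phi>) *\<^sub>R \<phi>))}"
    and c_delta: "i \<in> D \<Longrightarrow> 0 \<le> c i \<delta>"
begin

definition reflect :: "'v \<Rightarrow> 'v \<Rightarrow> 'v" where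
  "reflect \<phi> v = v - (2 * B \<phi> v / B \<phi> \<phi>) *\<^sub>R \<phi>"

definition pos :: "'v set" where
  "pos = {\<phi> \<in> \<Phi>. \<forall>i\<in>D. 0 \<le> c i \<phi>}"

definition word :: "'v list \<Rightarrow> 'v \<Rightarrow> 'v" where
  "word is = foldr (\<lambda>i g. reflect i \<circ> g) is id"

definition weyl :: "('v \<Rightarrow> 'v) set" where
  "weyl = word ` lists D"

definition ell :: "('v \<Rightarrow> 'v) \<Rightarrow> nat" where
  "ell h = (LEAST n. \<exists>is. set is \<subseteq> D \<and> length is = n \<and> word is = h)"

text \<open>With \<open>h\<close> the inverse of \<open>w\<close> this is N(w), the hyperplanes
  separating the chamber of \<open>w\<close> from the fundamental one.\<close>

definition inversions :: "('v \<Rightarrow> 'v) \<Rightarrow> 'v set" where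
  "inversions h = {\<psi> \<in> pos. h \<psi> \<notin> pos}"

text \<open>Comparing with \<delta> coordinate by coordinate, rather than listing two families of
  roots, makes \<open>not_small_comb\<close> immediate; \<open>small_eq\<close> identifies the
  result with the Shi roots.\<close>

definition small :: "'v set" where
  "small = {\<psi> \<in> pos. \<exists>i\<in>D. c i \<psi> < c i \<delta>}"

lemma c_simps:
  assumes "i \<in> D"
  shows "c i (u + v) = c i u + c i v" "c i (u - v) = c i u - c i v" "c i (- v) = - c i v"
    "c i (a *\<^sub>R v) = a * c i v" "c i 0 = 0"
  using linear_add[OF linear_c] linear_diff[OF linear_c] linear_neg[OF linear_c]
    linear_scale[OF linear_c] linear_0[OF linear_c] assms by auto

lemma root_nonzero: "\<phi> \<in> \<Phi> \<Longrightarrow> \<phi> \<noteq> 0"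
  using B_pos bilinear_lzero[OF bilinear_B] by (metis less_irrefl)

lemma B_simps:
  "B (u + v) z = B u z + B v z" "B u (v + z) = B u v + B u z"
  "B (u - v) z = B u z - B v z" "B u (v - z) = B u v - B u z"
  "B (a *\<^sub>R u) v = a * B u v" "B u (a *\<^sub>R v) = a * B u v"
  "B (- u) v = - B u v" "B u (- v) = - B u v"
  using bilinear_B
  by (simp_all add: bilinear_ladd bilinear_radd bilinear_lsub bilinear_rsub bilinear_lmul
      bilinear_rmul bilinear_lneg bilinear_rneg)

lemma linear_reflect: "linear (reflect \<phi>)"
  by (rule linearI) (simp_all add: reflect_def B_simps algebra_simps add_divide_distrib)

lemma reflect_self: "\<phi> \<in> \<Phi> \<Longrightarrow> reflect \<phi> \<phi> = - \<phi>"
  using B_pos[of \<phi>] by (simp add: reflect_def scaleR_2)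

lemma reflect_reflect [simp]: "\<phi> \<in> \<Phi> \<Longrightarrow> reflect \<phi> (reflect \<phi> v) = v"
  using B_pos[of \<phi>] by (simp add: reflect_def B_simps flip: scaleR_left.add)

lemma reflect_comp_reflect [simp]: "\<phi> \<in> \<Phi> \<Longrightarrow> reflect \<phi> \<circ> (reflect \<phi> \<circ> h) = h"
  by (simp add: fun_eq_iff)

lemma reflect_root: "\<phi> \<in> \<Phi> \<Longrightarrow> \<psi> \<in> \<Phi> \<Longrightarrow> reflect \<phi> \<psi> \<in> \<Phi>"
  unfolding reflect_def by (rule root_reflect)

lemma uminus_root [simp]: "- \<phi> \<in> \<Phi> \<longleftrightarrow> \<phi> \<in> \<Phi>"
  using reflect_root reflect_self by (metis minus_minus)

lemma B_reflect:
  assumes "\<phi> \<in> \<Phi>" shows "B (reflect \<phi> u) (reflect \<phi> v) = B u v"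
  using B_pos[OF assms] B_commute[of u \<phi>] by (simp add: reflect_def B_simps field_simps)

lemma pos_root: "\<phi> \<in> pos \<Longrightarrow> \<phi> \<in> \<Phi>"
  by (simp add: pos_def)

lemma D_pos: "i \<in> D \<Longrightarrow> i \<in> pos"
  using D_sub c_D by (auto simp: pos_def)

lemma D_root: "i \<in> D \<Longrightarrow> i \<in> \<Phi>"
  using D_sub by auto

lemma uminus_pos_iff: "\<phi> \<in> \<Phi> \<Longrightarrow> - \<phi> \<in> pos \<longleftrightarrow> \<phi> \<notin> pos"
proof -
  assume \<phi>: "\<phi> \<in> \<Phi>"
  have "\<not> (\<phi> \<in> pos \<and> - \<phi> \<in> pos)"
  proof
    assume a: "\<phi> \<in> pos \<and> - \<phi> \<in> pos"
    have "c i \<phi> = 0" if "i \<in> D" for i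
      using a that by (force simp: pos_def c_simps)
    then show False using c_eq_0 root_nonzero \<phi> by blast
  qed
  then show ?thesis using c_sign[OF \<phi>] \<phi> by (auto simp: pos_def c_simps)
qed

lemma notin_posD: "\<phi> \<in> \<Phi> \<Longrightarrow> \<phi> \<notin> pos \<Longrightarrow> i \<in> D \<Longrightarrow> c i \<phi> \<le> 0"
  using c_sign by (auto simp: pos_def)

lemma expansion: "v = (\<Sum>i\<in>D. c i v *\<^sub>R i)"
proof -
  have "c j (v - (\<Sum>i\<in>D. c i v *\<^sub>R i)) = 0" if "j \<in> D" for j
  proof -
    have "c j (\<Sum>i\<in>D. c i v *\<^sub>R i) = (\<Sum>i\<in>D. c i v * c j i)"
      by (simp only: linear_sum[OF linear_c[OF that]] c_simps(4)[OF that])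
    also have "\<dots> = (\<Sum>i\<in>D. if i = j then c j v else 0)"
      by (rule sum.cong) (auto simp: c_D that)
    also have "\<dots> = c j v" using that finite_D by simp
    finally show ?thesis by (simp only: c_simps(2)[OF that])
  qed
  then have "v - (\<Sum>i\<in>D. c i v *\<^sub>R i) = 0" by (rule c_eq_0)
  then show ?thesis by simp
qed

lemma linear_pos:
  fixes f :: "'v \<Rightarrow> real"
  assumes "linear f" "\<And>i. i \<in> D \<Longrightarrow> 0 < f i" "\<phi> \<in> pos"
  shows "0 < f \<phi>"
proof -
  have *: "f \<phi> = (\<Sum>i\<in>D. c i \<phi> * f i)"
    by (subst expansion[of \<phi>]) (simp add: linear_sum[OF assms(1)] linear_scale[OF assms(1)])
  obtain j where j: "j \<in> D" "c j \<phi> \<noteq> 0"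
    using c_eq_0 root_nonzero pos_root assms(3) by blast
  then have "0 < c j \<phi>" using assms(3) by (auto simp: pos_def less_le)
  then show ?thesis unfolding *
    using assms j finite_D by (intro sum_pos2[of D j]) (auto simp: pos_def less_imp_le)
qed

lemma c_reflect: "i \<in> D \<Longrightarrow> k \<in> D \<Longrightarrow> k \<noteq> i \<Longrightarrow> c k (reflect i v) = c k v"
  by (simp add: reflect_def c_simps c_D)

text \<open>Only the coordinate at \<open>i\<close> moves. If the image were negative, all other
  coordinates would vanish, so \<phi> would be a multiple of \<open>i\<close>, and reducedness
  leaves only \<open>i\<close> itself.\<close>

lemma reflect_pos:
  assumes "i \<in> D" "\<phi> \<in> pos" "\<phi> \<noteq> i"
  shows "reflect i \<phi> \<in> pos"
proof (rule ccontr)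
  assume n: "reflect i \<phi> \<notin> pos"
  have r: "reflect i \<phi> \<in> \<Phi>" using assms D_root pos_root reflect_root by blast
  have z: "c k \<phi> = 0" if "k \<in> D" "k \<noteq> i" for k
    using notin_posD[OF r n that(1)] c_reflect[OF assms(1) that] assms(2) that by (auto simp: pos_def)
  have "\<phi> - c i \<phi> *\<^sub>R i = 0"
    by (rule c_eq_0) (use assms(1) z c_D in \<open>auto simp: c_simps\<close>)
  then have e: "\<phi> = c i \<phi> *\<^sub>R i" by simp
  then have "c i \<phi> = 1 \<or> c i \<phi> = -1"
    using reduced assms(1,2) pos_root by metis
  moreover have "0 \<le> c i \<phi>" using assms by (auto simp: pos_def)
  ultimately show False using e assms(3) by auto
qed

lemma reflect_notin_pos: "i \<in> D \<Longrightarrow> reflect i i \<notin> pos"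
  using reflect_self D_root D_pos uminus_pos_iff by auto

section \<open>Words in the simple reflections, the group they generate, and exchange\<close>

lemma word_simps [simp]: "word [] = id" "word (i # is) = reflect i \<circ> word is"
  by (simp_all add: word_def)

lemma word_append: "word (is @ js) = word is \<circ> word js"
  by (induction "is") (auto simp: fun_eq_iff)

lemma word_weyl: "set is \<subseteq> D \<Longrightarrow> word is \<in> weyl"
  by (auto simp: weyl_def)

lemma weyl_cases:
  assumes "h \<in> weyl" obtains "is" where "set is \<subseteq> D" "h = word is"
  using assms by (auto simp: weyl_def)

lemma weyl_comp: "g \<in> weyl \<Longrightarrow> h \<in> weyl \<Longrightarrow> g \<circ> h \<in> weyl"
  by (elim weyl_cases) (auto simp flip: word_append intro!: word_weyl)

lemma reflect_weyl: "i \<in> D \<Longrightarrow> reflect i \<in> weyl"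
  using word_weyl[of "[i]"] by simp

lemma word_rev: "set is \<subseteq> D \<Longrightarrow> word (rev is) \<circ> word is = id"
  by (induction "is") (auto simp: word_append fun_eq_iff D_root)

lemma weyl_inverse:
  assumes "h \<in> weyl"
  obtains g where "g \<in> weyl" "g \<circ> h = id" "h \<circ> g = id"
proof -
  obtain "is" where "is": "set is \<subseteq> D" "h = word is" using assms by (rule weyl_cases)
  show ?thesis
    by (rule that[of "word (rev is)"]) (use "is" word_rev[of "is"] word_rev[of "rev is"] word_weyl in auto)
qed

lemma weyl_induct [consumes 1, case_names id reflect]:
  assumes "h \<in> weyl" "P id" "\<And>i h. i \<in> D \<Longrightarrow> h \<in> weyl \<Longrightarrow> P h \<Longrightarrow> P (reflect i \<circ> h)"
  shows "P h"
proof -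
  obtain "is" where "is": "set is \<subseteq> D" "h = word is" using assms(1) by (rule weyl_cases)
  have "P (word is)" using "is"(1)
    by (induction "is") (auto intro!: assms word_weyl)
  then show ?thesis using "is" by simp
qed

lemma weyl_linear: "h \<in> weyl \<Longrightarrow> linear h"
proof (induction rule: weyl_induct)
  case id
  show ?case by (rule linear_id)
next
  case (reflect i h)
  show ?case by (rule linear_compose[OF reflect.IH linear_reflect])
qed

lemma weyl_root: "h \<in> weyl \<Longrightarrow> \<phi> \<in> \<Phi> \<Longrightarrow> h \<phi> \<in> \<Phi>"
  by (induction rule: weyl_induct) (auto intro: reflect_root D_root)

lemma weyl_root_surj:
  assumes "h \<in> weyl" "\<phi> \<in> \<Phi>" obtains \<psi> where "\<psi> \<in> \<Phi>" "h \<psi> = \<phi>"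
  using assms weyl_inverse weyl_root by (metis comp_eq_dest_lhs id_apply)

lemma weyl_inj: "h \<in> weyl \<Longrightarrow> h u = h v \<Longrightarrow> u = v"
  using weyl_inverse by (metis comp_eq_dest_lhs id_apply)

lemma weyl_simps:
  assumes "h \<in> weyl"
  shows "h (u + v) = h u + h v" "h (u - v) = h u - h v" "h (- v) = - h v" "h (a *\<^sub>R v) = a *\<^sub>R h v"
  using weyl_linear[OF assms] by (simp_all add: linear_add linear_diff linear_neg linear_scale)

lemma weyl_B: "h \<in> weyl \<Longrightarrow> B (h u) (h v) = B u v"
  by (induction rule: weyl_induct) (simp_all add: B_reflect D_root)

lemma weyl_reflect: "h \<in> weyl \<Longrightarrow> h (reflect \<phi> v) = reflect (h \<phi>) (h v)"
  by (simp add: reflect_def weyl_simps weyl_B)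

text \<open>Read from the right, some letter turns the image of \<beta> from positive to negative. A
  simple reflection does this only to its own root, so the image just before is that letter.\<close>

lemma word_exchange:
  assumes "set is \<subseteq> D" "\<beta> \<in> pos" "word is \<beta> \<notin> pos"
  obtains js j ks where "is = js @ j # ks" "word ks \<beta> = j"
proof -
  have "\<exists>js j ks. is = js @ j # ks \<and> word ks \<beta> = j"
    using assms(1,3)
  proof (induction "is")
    case Nil
    then show ?case using assms(2) by simp
  next
    case (Cons i "is")
    show ?case
    proof (cases "word is \<beta> \<in> pos")
      case True
      then have "word is \<beta> = i" using reflect_pos Cons.prems by auto
      then show ?thesis by blast
    next
      case False
      then show ?thesis using Cons by (metis append_Cons list.set_intros(2) subset_code(1))
    qed
  qed
  then show ?thesis using that by blast
qed

section \<open>Length and descents\<close>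

lemma ell_word:
  assumes "h \<in> weyl"
  obtains "is" where "set is \<subseteq> D" "length is = ell h" "word is = h"
proof -
  have "\<exists>n is. set is \<subseteq> D \<and> length is = n \<and> word is = h"
    using assms by (metis weyl_cases)
  from LeastI_ex[OF this] show ?thesis using that unfolding ell_def by blast
qed

lemma ell_le: "set is \<subseteq> D \<Longrightarrow> ell (word is) \<le> length is"
  unfolding ell_def by (rule Least_le) blast

text \<open>The letter found by exchange can be deleted: conjugated to the front of the word it
  becomes \<open>reflect i\<close>, which cancels.\<close>

lemma ell_descent:
  assumes "h \<in> weyl" "i \<in> D" "\<beta> \<in> pos" "h \<beta> = - i"
  shows "ell (reflect i \<circ> h) < ell h"
proof -
  obtain "is" where "is": "set is \<subseteq> D" "length is = ell h" "word is = h"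
    using ell_word[OF assms(1)] .
  have "word is \<beta> \<notin> pos" using "is" assms D_pos D_root uminus_pos_iff by simp
  then obtain js j ks where s: "is = js @ j # ks" "word ks \<beta> = j"
    using word_exchange "is"(1) assms(3) by metis
  have w: "word js \<in> weyl" "j \<in> \<Phi>" using s "is" word_weyl D_root by auto
  have "h \<beta> = - word js j"
    using s by (simp flip: "is"(3) add: word_append reflect_self w weyl_simps)
  then have "word js j = i" using assms(4) by simp
  then have "reflect i \<circ> h = word (js @ ks)"
    using s weyl_reflect[OF w(1), of j]
    by (auto simp: word_append fun_eq_iff w simp flip: "is"(3))
       (metis reflect_reflect w(2))
  then have "ell (reflect i \<circ> h) \<le> length (js @ ks)"
    using ell_le[of "js @ ks"] s "is" by auto
  then show ?thesis using s "is" by simp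
qed

lemma ell_descent_iff:
  assumes "h \<in> weyl" "i \<in> D"
  shows "ell (reflect i \<circ> h) < ell h \<longleftrightarrow> (\<exists>\<beta>\<in>pos. h \<beta> = - i)"
proof
  assume l: "ell (reflect i \<circ> h) < ell h"
  obtain \<beta> where b: "\<beta> \<in> \<Phi>" "h \<beta> = - i"
    using weyl_root_surj assms D_root uminus_root by metis
  show "\<exists>\<beta>\<in>pos. h \<beta> = - i"
  proof (cases "\<beta> \<in> pos")
    \<comment> \<open>Now \<open>reflect i \<circ> h\<close> is the one with the descent, and
      \<open>ell_descent\<close> gives the opposite inequality.\<close>
    case False
    then have "- \<beta> \<in> pos" using b uminus_pos_iff by auto
    moreover have "(reflect i \<circ> h) (- \<beta>) = - i"
      using b assms by (simp add: weyl_simps reflect_self D_root)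
    ultimately have "ell (reflect i \<circ> (reflect i \<circ> h)) < ell (reflect i \<circ> h)"
      using ell_descent[of "reflect i \<circ> h"] assms weyl_comp reflect_weyl by blast
    then show ?thesis using l assms D_root by simp
  qed (use b in auto)
qed (use ell_descent assms in blast)

text \<open>A shortest word for the inverse has no first letter: such a letter \<open>i\<close>
  would be a descent of the inverse, with root \<open>- h i\<close>, which is not positive.\<close>

lemma weyl_eq_id:
  assumes "h \<in> weyl" "\<And>i. i \<in> D \<Longrightarrow> h i \<in> pos"
  shows "h = id"
proof -
  obtain g where g: "g \<in> weyl" "g \<circ> h = id" "h \<circ> g = id" using weyl_inverse[OF assms(1)] .
  have nd: "\<not> ell (reflect i \<circ> g) < ell g" if "i \<in> D" for i
  proof -
    have "\<beta> = - h i" if "g \<beta> = - i" for \<beta>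
      using g that assms(1) weyl_simps(3) by (metis comp_apply id_apply)
    then show ?thesis
      using ell_descent_iff[OF g(1) that] assms that uminus_pos_iff pos_root by blast
  qed
  obtain "is" where "is": "set is \<subseteq> D" "length is = ell g" "word is = g"
    using ell_word[OF g(1)] .
  have "is = []"
  proof (cases "is")
    case (Cons i js)
    then have "reflect i \<circ> g = word js" using "is" D_root by (auto simp flip: "is"(3))
    then have "ell (reflect i \<circ> g) < ell g" using ell_le[of js] "is" Cons by auto
    then show ?thesis using nd[of i] "is" Cons by auto
  qed auto
  then show ?thesis using "is" g by auto
qed

text \<open>Along the orbit of the functional, minimise the number of positive roots on which it is
  negative.\<close>

lemma functional_chamber:
  fixes f :: "'v \<Rightarrow> real"
  assumes f: "linear f" and nz: "\<And>\<psi>. \<psi> \<in> \<Phi> \<Longrightarrow> f \<psi> \<noteq> 0" and fin: "finite {\<psi> \<in> pos. f \<psi> < 0}"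
  obtains g where "g \<in> weyl" "\<And>\<psi>. \<psi> \<in> pos \<Longrightarrow> 0 < f (g \<psi>)"
proof -
  define S where "S g = {\<psi> \<in> pos. f (g \<psi>) < 0}" for g
  \<comment> \<open>Multiplying by \<open>reflect i\<close> on the right permutes the positive roots
    other than \<open>i\<close>, so apart from this permutation only the membership of
    \<open>i\<close> changes.\<close>
  have step: "S (g \<circ> reflect i) \<subseteq> reflect i ` (S g - {i}) \<union> (if 0 < f (g i) then {i} else {})"
    if "g \<in> weyl" "i \<in> D" for g i
  proof
    fix \<psi> assume "\<psi> \<in> S (g \<circ> reflect i)"
    then have p: "\<psi> \<in> pos" "f (g (reflect i \<psi>)) < 0" by (auto simp: S_def)
    show "\<psi> \<in> reflect i ` (S g - {i}) \<union> (if 0 < f (g i) then {i} else {})"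
    proof (cases "\<psi> = i")
      case True
      then show ?thesis
        using p that by (simp add: reflect_self D_root weyl_simps linear_neg[OF f])
    next
      case False
      have "reflect i \<psi> \<in> S g" using p reflect_pos that False by (auto simp: S_def)
      moreover have "reflect i \<psi> \<noteq> i"
        using that False p reflect_self reflect_reflect D_root uminus_pos_iff D_pos by metis
      ultimately show ?thesis using that D_root by (intro UnI1 image_eqI[of _ _ "reflect i \<psi>"]) auto
    qed
  qed
  have fin_S: "finite (S g)" if g: "g \<in> weyl" for g
  proof -
    obtain "is" where "is": "set is \<subseteq> D" "g = word is" using g by (rule weyl_cases)
    have "finite (S (word is))" using "is"(1)
    proof (induction "is" rule: rev_induct)
      case Nil
      then show ?case using fin by (simp add: S_def)
    next
      case (snoc i "is")
      then have "finite (reflect i ` (S (word is) - {i}) \<union> (if 0 < f (word is i) then {i} else {}))"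
        by auto
      moreover have "word (is @ [i]) = word is \<circ> reflect i" by (simp add: word_append)
      ultimately show ?case
        using finite_subset[OF step[of "word is" i]] snoc.prems word_weyl[of "is"]
        by (metis insert_subset list.simps(15) set_append le_sup_iff)
    qed
    then show ?thesis using "is" by simp
  qed
  have "\<exists>g. g \<in> weyl" using word_weyl[of "[]"] by auto
  then obtain g where g: "g \<in> weyl" "\<And>g'. g' \<in> weyl \<Longrightarrow> card (S g) \<le> card (S g')"
    using ex_has_least_nat[of "\<lambda>g. g \<in> weyl" _ "\<lambda>g. card (S g)"] by blast
  have "0 < f (g i)" if i: "i \<in> D" for i
  proof (rule ccontr)
    assume n: "\<not> 0 < f (g i)"
    then have "f (g i) < 0" using nz[of "g i"] weyl_root g i D_root by (metis linorder_neqE_linordered_idom)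
    then have "i \<in> S g" using D_pos i by (auto simp: S_def)
    have "S (g \<circ> reflect i) \<subseteq> reflect i ` (S g - {i})" using step[OF g(1) i] n by simp
    then have "card (S (g \<circ> reflect i)) \<le> card (S g - {i})"
      by (meson surj_card_le fin_S g(1) finite_Diff)
    also have "\<dots> < card (S g)" using \<open>i \<in> S g\<close> fin_S g(1) by (meson card_Diff1_less)
    finally show False using g(2)[of "g \<circ> reflect i"] weyl_comp g(1) reflect_weyl i by fastforce
  qed
  then have "0 < f (g \<psi>)" if "\<psi> \<in> pos" for \<psi>
    using linear_pos[of "f \<circ> g"] linear_compose[OF weyl_linear[OF g(1)] f] that by auto
  then show ?thesis using that g by blast
qed

text \<open>The height composed with \<open>reflect \<phi>\<close> is a functional that is negative
  on \<phi>. The group element moving its chamber to the fundamental one therefore makes \<phi>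
  negative, and exchange finds a suffix of its word that sends \<phi> to a simple root.\<close>

lemma pos_conj_simple:
  assumes "\<phi> \<in> pos"
  obtains "is" j where "set is \<subseteq> D" "j \<in> D" "word is \<phi> = j"
proof -
  define f where "f v = (\<Sum>i\<in>D. c i v)" for v
  have f: "linear f" unfolding f_def using linear_c by (intro linear_compose_sum) auto
  have fD: "f i = 1" if "i \<in> D" for i
    using that finite_D by (simp add: f_def c_D sum.delta cong: sum.cong)
  have fp: "0 < f \<psi>" if "\<psi> \<in> pos" for \<psi> using linear_pos[OF f] fD that by auto
  have fn: "f \<psi> < 0" if "\<psi> \<in> \<Phi>" "\<psi> \<notin> pos" for \<psi>
    using fp[of "- \<psi>"] uminus_pos_iff that linear_neg[OF f] by auto
  have \<phi>: "\<phi> \<in> \<Phi>" using assms pos_root by auto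
  let ?f = "f \<circ> reflect \<phi>"
  have "linear ?f" by (rule linear_compose[OF linear_reflect f])
  moreover have "?f \<psi> \<noteq> 0" if "\<psi> \<in> \<Phi>" for \<psi>
    using fp fn reflect_root[OF \<phi> that] by (metis comp_apply less_irrefl)
  moreover have "finite {\<psi> \<in> pos. ?f \<psi> < 0}"
    by (rule finite_subset[OF _ finite_reflect[OF \<phi>]])
      (use fp reflect_root[OF \<phi>] in \<open>force simp: pos_def reflect_def\<close>)
  ultimately obtain g where g: "g \<in> weyl" "\<And>\<psi>. \<psi> \<in> pos \<Longrightarrow> 0 < f (reflect \<phi> (g \<psi>))"
    using functional_chamber[of ?f] by auto
  obtain h where h: "h \<in> weyl" "h \<circ> g = id" "g \<circ> h = id" using weyl_inverse[OF g(1)] .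
  have "h \<phi> \<notin> pos"
  proof
    assume "h \<phi> \<in> pos"
    then have "0 < f (reflect \<phi> (g (h \<phi>)))" using g by blast
    moreover have "g (h \<phi>) = \<phi>" using h by (metis comp_apply id_apply)
    ultimately show False using fp[OF assms] by (simp add: reflect_self \<phi> linear_neg[OF f])
  qed
  moreover obtain "is" where "is": "set is \<subseteq> D" "h = word is" using h(1) by (rule weyl_cases)
  ultimately obtain js j ks where "is = js @ j # ks" "word ks \<phi> = j"
    using word_exchange assms by metis
  then show ?thesis using that[of ks j] "is" by auto
qed

text \<open>Bridges two generating sets: \<open>affine_weyl\<close> is generated by all reflections,
  \<open>weyl\<close> by the simple ones.\<close>

lemma reflect_in_weyl:
  assumes "\<phi> \<in> pos" shows "reflect \<phi> \<in> weyl"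
proof -
  obtain "is" j where "is": "set is \<subseteq> D" "j \<in> D" "word is \<phi> = j" using pos_conj_simple[OF assms] .
  have w: "word is \<in> weyl" using "is" word_weyl by auto
  obtain g where g: "g \<in> weyl" "g \<circ> word is = id" "word is \<circ> g = id" using weyl_inverse[OF w] .
  have "reflect \<phi> v = (g \<circ> (reflect j \<circ> word is)) v" for v
    using weyl_reflect[OF w, of \<phi> v] "is" g by (metis comp_apply id_apply)
  then show ?thesis
    using weyl_comp g(1) w reflect_weyl "is"(2) by (metis ext)
qed

text \<open>Simple reflections preserve the lattice of vectors with integral coordinates, and every
  root is, up to sign, in the orbit of a simple root.\<close>

lemma c_int:
  assumes "\<phi> \<in> \<Phi>" "i \<in> D" shows "c i \<phi> \<in> \<int>"
proof -
  define L where "L = {v. \<forall>i\<in>D. c i v \<in> \<int>}"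
  have L_reflect: "reflect j v \<in> L" if "j \<in> D" "v \<in> L" for j v
  proof -
    have "2 * B j v / B j j = (\<Sum>k\<in>D. c k v * (2 * B j k / B j j))"
    proof -
      have "linear (B j)" using bilinear_B by (simp add: bilinear_def)
      then have "B j (\<Sum>k\<in>D. c k v *\<^sub>R k) = (\<Sum>k\<in>D. c k v * B j k)"
        by (simp add: linear_sum B_simps)
      then have "B j v = (\<Sum>k\<in>D. c k v * B j k)"
        using expansion[of v] by simp
      then show ?thesis
        by (simp add: sum_distrib_left sum_divide_distrib mult.left_commute)
    qed
    also have "\<dots> \<in> \<int>"
      using that cartan_int by (intro Ints_sum Ints_mult) (auto simp: L_def)
    finally have n: "2 * B j v / B j j \<in> \<int>" .
    show ?thesis unfolding L_def
      using n that by (auto simp: reflect_def c_simps c_D L_def intro!: Ints_diff)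
  qed
  have L_weyl: "h v \<in> L" if "h \<in> weyl" "v \<in> L" for h v
    using that by (induction rule: weyl_induct) (auto intro: L_reflect)
  have L_D: "j \<in> L" if "j \<in> D" for j using that by (auto simp: L_def c_D)
  have L_pos: "\<psi> \<in> L" if p: "\<psi> \<in> pos" for \<psi>
  proof -
    obtain "is" j where "is": "set is \<subseteq> D" "j \<in> D" "word is \<psi> = j" using pos_conj_simple[OF p] .
    obtain g where g: "g \<in> weyl" "g \<circ> word is = id" using weyl_inverse[OF word_weyl[OF "is"(1)]] by blast
    then have "\<psi> = g j" using "is" by (metis comp_apply id_apply)
    then show ?thesis using L_weyl L_D "is" g by auto
  qed
  show ?thesis
  proof (cases "\<phi> \<in> pos")
    case True
    then show ?thesis using L_pos assms by (auto simp: L_def)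
  next
    case False
    then have "c i (- \<phi>) \<in> \<int>" using L_pos[of "- \<phi>"] assms uminus_pos_iff by (auto simp: L_def)
    then show ?thesis using assms by (simp add: c_simps)
  qed
qed


section \<open>Inversion sets and regions cut out by small roots\<close>

lemma inversions_iff: "\<psi> \<in> pos \<Longrightarrow> \<psi> \<in> inversions h \<longleftrightarrow> h \<psi> \<notin> pos"
  by (simp add: inversions_def)

lemma uminus_simple_notin_pos: "i \<in> D \<Longrightarrow> - i \<notin> pos"
  using uminus_pos_iff D_root D_pos by blast

text \<open>Adjacent chambers are separated by their common wall and by no other hyperplane, because
  \<open>reflect i\<close> changes the sign of no root other than \<open>i\<close> and
  \<open>- i\<close>.\<close>

lemma inversions_reflect:
  assumes "h \<in> weyl" "i \<in> D" "\<psi> \<in> pos" "h \<psi> = i \<or> h \<psi> = - i"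
  shows "inversions (reflect i \<circ> h) = (if h \<psi> = i then insert \<psi> (inversions h) else inversions h - {\<psi>})"
proof -
  have ne: "i \<noteq> - i" using D_pos uminus_simple_notin_pos assms(2) by force
  have neg: "reflect i (- i) = i"
    using reflect_self D_root assms(2) reflect_reflect by metis
  have "reflect i (h \<phi>) \<in> pos \<longleftrightarrow> h \<phi> \<in> pos" if p: "\<phi> \<in> pos" "\<phi> \<noteq> \<psi>" for \<phi>
  proof -
    have n: "h \<phi> \<noteq> i" "h \<phi> \<noteq> - i"
    proof -
      have "\<phi> \<noteq> - \<psi>" using p assms(3) uminus_pos_iff pos_root by blast
      then have "h \<phi> \<noteq> - h \<psi>" "h \<phi> \<noteq> h \<psi>"
        using weyl_inj[OF assms(1)] p weyl_simps(3)[OF assms(1)] by metis+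
      then show "h \<phi> \<noteq> i" "h \<phi> \<noteq> - i" using assms(4) by auto
    qed
    have r: "h \<phi> \<in> \<Phi>" using weyl_root assms(1) p pos_root by blast
    show ?thesis
    proof (cases "h \<phi> \<in> pos")
      case True
      then show ?thesis using reflect_pos[OF assms(2)] n by blast
    next
      case False
      then have "- h \<phi> \<in> pos" "- h \<phi> \<noteq> i" using uminus_pos_iff r n by auto
      then have "reflect i (- h \<phi>) \<in> pos" using reflect_pos[OF assms(2)] by blast
      then have "- reflect i (h \<phi>) \<in> pos" by (simp add: linear_neg[OF linear_reflect])
      then show ?thesis using False uminus_pos_iff reflect_root r D_root assms(2) by blast
    qed
  qed
  moreover have "reflect i (h \<psi>) \<in> pos \<longleftrightarrow> h \<psi> = - i"
    using assms ne neg reflect_notin_pos D_pos by metis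
  ultimately show ?thesis using assms(2,3,4) ne D_pos uminus_simple_notin_pos
    by (auto simp: inversions_def)
qed

lemma inversions_descent:
  assumes "h \<in> weyl" "i \<in> D" "\<psi> \<in> pos" "h \<psi> = - i"
  shows "inversions (reflect i \<circ> h) = inversions h - {\<psi>}" "\<psi> \<in> inversions h"
proof -
  have "- i \<noteq> i" using D_pos uminus_simple_notin_pos assms(2) by metis
  then show "inversions (reflect i \<circ> h) = inversions h - {\<psi>}"
    using inversions_reflect[OF assms(1,2,3)] assms(4) by simp
  show "\<psi> \<in> inversions h"
    using assms uminus_simple_notin_pos by (simp add: inversions_def)
qed

lemma finite_inversions: "h \<in> weyl \<Longrightarrow> finite (inversions h)"
proof (induction rule: weyl_induct)
  case id
  then show ?case by (simp add: inversions_def)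
next
  case (reflect i h)
  obtain \<psi> where p: "\<psi> \<in> \<Phi>" "h \<psi> = i" using weyl_root_surj reflect D_root by metis
  have "\<exists>\<psi>\<in>pos. h \<psi> = i \<or> h \<psi> = - i"
    using p uminus_pos_iff[of \<psi>] weyl_simps(3)[OF reflect.hyps(2), of \<psi>] by auto
  then obtain \<phi> where "\<phi> \<in> pos" "h \<phi> = i \<or> h \<phi> = - i" by blast
  from inversions_reflect[OF reflect.hyps(2,1) this] show ?case
    using reflect.IH by (metis finite_insert finite_Diff)
qed

text \<open>If \<open>u\<close> were on the same side as \<open>t\<close> of every wall of
  \<open>t\<close>, then \<open>u\<close> composed with the inverse of \<open>t\<close> would keep
  all simple roots positive and be the identity.\<close>

lemma exists_separating_wall:
  assumes "t \<in> weyl" "u \<in> weyl" "t \<noteq> u"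
  obtains (wall) i \<psi> where "i \<in> D" "\<psi> \<in> pos" "t \<psi> = i \<and> u \<psi> \<notin> pos \<or> t \<psi> = - i \<and> u \<psi> \<in> pos"
proof (rule ccontr)
  assume n: "\<not> thesis"
  obtain g where g: "g \<in> weyl" "g \<circ> t = id" "t \<circ> g = id" using weyl_inverse[OF assms(1)] .
  have "(u \<circ> g) i \<in> pos" if i: "i \<in> D" for i
  proof -
    have gi: "g i \<in> \<Phi>" "t (g i) = i" using g i weyl_root D_root by (auto simp: fun_eq_iff)
    show ?thesis
    proof (cases "g i \<in> pos")
      case True
      then show ?thesis using n wall[of i "g i"] gi i by auto
    next
      case False
      then have "- g i \<in> pos" "t (- g i) = - i"
        using gi uminus_pos_iff by (auto simp: weyl_simps assms)
      then have "u (- g i) \<notin> pos" using n wall i by metis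
      then show ?thesis using weyl_root[OF assms(2) gi(1)] uminus_pos_iff
        by (auto simp: weyl_simps assms)
    qed
  qed
  then have "u \<circ> g = id" using weyl_eq_id weyl_comp assms(2) g(1) by blast
  then have "u = t" using g by (metis comp_assoc comp_id id_comp)
  then show False using assms by simp
qed

section \<open>Chambers around a codimension-two face\<close>

lemma word_coord:
  "set xs \<subseteq> S \<Longrightarrow> S \<subseteq> D \<Longrightarrow> k \<in> D \<Longrightarrow> k \<notin> S \<Longrightarrow> c k (word xs v) = c k v"
proof (induction xs)
  case (Cons i xs)
  then have "i \<in> D" "k \<noteq> i" by auto
  then show ?case using Cons c_reflect by simp
qed simp

lemma expansion_2:
  assumes "i \<in> D" "j \<in> D" "i \<noteq> j" "\<And>k. k \<in> D \<Longrightarrow> k \<notin> {i, j} \<Longrightarrow> c k v = 0"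
  shows "v = c i v *\<^sub>R i + c j v *\<^sub>R j"
proof -
  have "v = (\<Sum>k\<in>{i, j}. c k v *\<^sub>R k)"
    by (subst expansion[of v], rule sum.mono_neutral_right) (use assms finite_D in auto)
  then show ?thesis using assms(3) by simp
qed

lemma nonneg_comb_pos:
  assumes "\<phi> \<in> pos" "\<psi> \<in> pos" "0 \<le> a" "0 \<le> b" "a *\<^sub>R \<phi> + b *\<^sub>R \<psi> \<in> \<Phi>"
  shows "a *\<^sub>R \<phi> + b *\<^sub>R \<psi> \<in> pos"
  using assms by (auto simp: pos_def c_simps)

lemma nonpos_comb_notin_pos:
  assumes "\<phi> \<in> pos" "\<psi> \<in> pos" "a \<le> 0" "b \<le> 0" "a *\<^sub>R \<phi> + b *\<^sub>R \<psi> \<in> \<Phi>"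
  shows "a *\<^sub>R \<phi> + b *\<^sub>R \<psi> \<notin> pos"
proof -
  have e: "- (a *\<^sub>R \<phi> + b *\<^sub>R \<psi>) = (- a) *\<^sub>R \<phi> + (- b) *\<^sub>R \<psi>" by simp
  have "- (a *\<^sub>R \<phi> + b *\<^sub>R \<psi>) \<in> pos"
    unfolding e by (rule nonneg_comb_pos) (use assms uminus_root[of "a *\<^sub>R \<phi> + b *\<^sub>R \<psi>"] in \<open>auto simp: e\<close>)
  then show ?thesis using uminus_pos_iff assms(5) by blast
qed

text \<open>The hyperplane of \<phi> contains the face where the walls \<open>x\<close> and
  \<open>y\<close> meet. The coordinates of a root have one sign, and both coefficients nonpositive
  would make \<phi> negative; \<open>c_int\<close> makes them integers.\<close>

lemma rank2_cone:
  assumes h: "h \<in> weyl" and ij: "i \<in> D" "j \<in> D" "i \<noteq> j"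
    and xy: "x \<in> pos" "y \<in> pos" "h x = s *\<^sub>R i" "h y = s *\<^sub>R j" "s = 1 \<or> s = -1"
    and \<phi>: "\<phi> \<in> pos" "\<And>k. k \<in> D \<Longrightarrow> k \<notin> {i, j} \<Longrightarrow> c k (h \<phi>) = 0"
  obtains p q where "\<phi> = p *\<^sub>R x + q *\<^sub>R y" "0 \<le> p" "0 \<le> q" "p \<in> \<int>" "q \<in> \<int>"
proof -
  define p q where "p = s * c i (h \<phi>)" and "q = s * c j (h \<phi>)"
  have e: "h \<phi> = c i (h \<phi>) *\<^sub>R i + c j (h \<phi>) *\<^sub>R j" by (rule expansion_2[OF ij \<phi>(2)])
  have "h (p *\<^sub>R x + q *\<^sub>R y) = (p * s) *\<^sub>R i + (q * s) *\<^sub>R j" by (simp add: weyl_simps h xy)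
  also have "\<dots> = c i (h \<phi>) *\<^sub>R i + c j (h \<phi>) *\<^sub>R j" using xy(5) by (auto simp: p_def q_def)
  finally have \<phi>e: "\<phi> = p *\<^sub>R x + q *\<^sub>R y" using weyl_inj[OF h] e by metis
  have r: "h \<phi> \<in> \<Phi>" using weyl_root h \<phi> pos_root by blast
  have "0 \<le> p \<and> 0 \<le> q \<or> p \<le> 0 \<and> q \<le> 0" using c_sign[OF r] ij xy(5) by (auto simp: p_def q_def)
  moreover have "\<not> (p \<le> 0 \<and> q \<le> 0)"
    using nonpos_comb_notin_pos[OF xy(1,2), of p q] \<phi>(1) pos_root \<phi>e by blast
  moreover have "p \<in> \<int>" "q \<in> \<int>" using c_int[OF r] ij xy(5) by (auto simp: p_def q_def)
  ultimately show ?thesis using that[OF \<phi>e] by blast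
qed

text \<open>Passing from one descent chamber to another one around the same codimension-two face
  only changes the sign of roots in the cone over the two walls.\<close>

lemma rank2_sign_change:
  assumes h: "h \<in> weyl" and ij: "i \<in> D" "j \<in> D" "i \<noteq> j"
    and bg: "\<beta> \<in> pos" "\<gamma> \<in> pos" "h \<beta> = - i" "h \<gamma> = - j"
    and xs: "set xs \<subseteq> {i, j}" and \<psi>: "\<psi> \<in> pos"
    and sign: "(h \<psi> \<in> pos) \<noteq> (word xs (h \<psi>) \<in> pos)"
  obtains a b where "\<psi> = a *\<^sub>R \<beta> + b *\<^sub>R \<gamma>" "0 \<le> a" "0 \<le> b" "a \<in> \<int>" "b \<in> \<int>"
proof -
  have ijD: "{i, j} \<subseteq> D" using ij by auto
  have r: "h \<psi> \<in> \<Phi>" using weyl_root h \<psi> pos_root by blast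
  have wr: "word xs (h \<psi>) \<in> \<Phi>" using weyl_root[OF word_weyl r] xs ij by auto
  have "c k (h \<psi>) = 0" if k: "k \<in> D" "k \<notin> {i, j}" for k
  proof (rule ccontr)
    assume nz: "c k (h \<psi>) \<noteq> 0"
    have e: "c k (word xs (h \<psi>)) = c k (h \<psi>)" using word_coord[OF xs ijD k] .
    have "\<phi> \<in> pos \<longleftrightarrow> 0 < c k \<phi>" if "\<phi> \<in> \<Phi>" "c k \<phi> \<noteq> 0" for \<phi>
      using that k notin_posD[OF that(1) _ k(1)] by (force simp: pos_def)
    from this[OF r nz] this[OF wr] show False using e nz sign by simp
  qed
  with rank2_cone[OF h ij bg(1,2), of "-1"] bg \<psi> that show ?thesis by auto
qed

lemma no_descent_wall:
  assumes "h \<in> weyl" "i \<in> D" "\<And>\<psi>. \<psi> \<in> pos \<Longrightarrow> h \<psi> \<noteq> - i"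
  obtains b where "b \<in> pos" "h b = i"
proof -
  obtain b where b: "b \<in> \<Phi>" "h b = i" using weyl_root_surj assms D_root by metis
  have "h (- b) = - i" using b by (simp add: weyl_simps assms)
  then have "b \<in> pos" using assms(3)[of "- b"] uminus_pos_iff b by blast
  then show ?thesis using that b by blast
qed

text \<open>At a chamber without descents at \<open>i\<close> and \<open>j\<close>, the images of
  \<beta> and \<gamma> are nonnegative combinations of \<open>i\<close> and \<open>j\<close>, and
  conversely. Mutually inverse nonnegative matrices are monomial, so \<beta> goes to a multiple of a
  simple root, and by reducedness to that root.\<close>

lemma rank2_bottom:
  assumes h: "h \<in> weyl" and ij: "i \<in> D" "j \<in> D" "i \<noteq> j"
    and bg: "\<beta> \<in> pos" "\<gamma> \<in> pos" "h \<beta> = - i" "h \<gamma> = - j"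
    and xs: "set xs \<subseteq> {i, j}"
    and nd: "\<And>\<psi>. \<psi> \<in> pos \<Longrightarrow> word xs (h \<psi>) \<noteq> - i \<and> word xs (h \<psi>) \<noteq> - j"
  shows "word xs (h \<beta>) = i \<or> word xs (h \<beta>) = j"
proof -
  have ijD: "{i, j} \<subseteq> D" using ij by auto
  define h0 where "h0 = word xs \<circ> h"
  have h0: "h0 \<in> weyl" using word_weyl weyl_comp xs ij h unfolding h0_def by auto
  have h0_coord: "c k (h0 v) = c k (h v)" if "k \<in> D" "k \<notin> {i, j}" for k v
    using word_coord[OF xs ijD that] by (simp add: h0_def)
  obtain bi where bi: "bi \<in> pos" "h0 bi = i"
    using no_descent_wall[OF h0 ij(1)] nd by (auto simp: h0_def)
  obtain bj where bj: "bj \<in> pos" "h0 bj = j"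
    using no_descent_wall[OF h0 ij(2)] nd by (auto simp: h0_def)
  have up: "\<exists>a b. 0 \<le> a \<and> 0 \<le> b \<and> h0 \<phi> = a *\<^sub>R i + b *\<^sub>R j"
    if p: "\<phi> \<in> pos" "h \<phi> = - l" "l \<in> {i, j}" for \<phi> l
  proof -
    have "c k (h0 \<phi>) = 0" if k: "k \<in> D" "k \<notin> {i, j}" for k
      using h0_coord[OF k] p k ij by (auto simp: c_simps c_D)
    then obtain a b where ab: "\<phi> = a *\<^sub>R bi + b *\<^sub>R bj" "0 \<le> a" "0 \<le> b"
      using rank2_cone[OF h0 ij bi(1) bj(1), where s = 1 and \<phi> = \<phi>, OF _ _ _ p(1)] bi(2) bj(2)
      by (metis scaleR_one)
    have "h0 \<phi> = a *\<^sub>R i + b *\<^sub>R j" by (simp add: ab(1) weyl_simps h0 bi bj)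
    then show ?thesis using ab by blast
  qed
  have down: "\<exists>e f. 0 \<le> e \<and> 0 \<le> f \<and> l = e *\<^sub>R h0 \<beta> + f *\<^sub>R h0 \<gamma>"
    if p: "b \<in> pos" "h0 b = l" "l \<in> {i, j}" for b l
  proof -
    have "c k (h b) = 0" if k: "k \<in> D" "k \<notin> {i, j}" for k
      using h0_coord[OF k, of b] p k ij by (auto simp: c_D)
    then obtain e f where ef: "b = e *\<^sub>R \<beta> + f *\<^sub>R \<gamma>" "0 \<le> e" "0 \<le> f"
      using rank2_cone[OF h ij bg(1,2), where s = "-1" and \<phi> = b, OF _ _ _ p(1)] bg(3,4)
      by (metis scaleR_minus1_left)
    have "h0 b = e *\<^sub>R h0 \<beta> + f *\<^sub>R h0 \<gamma>" by (simp add: ef(1) weyl_simps h0)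
    then show ?thesis using ef p(2) by blast
  qed
  obtain a b where \<mu>: "0 \<le> a" "0 \<le> b" "h0 \<beta> = a *\<^sub>R i + b *\<^sub>R j" using up[of \<beta> i] bg by auto
  obtain a' b' where \<nu>: "0 \<le> a'" "0 \<le> b'" "h0 \<gamma> = a' *\<^sub>R i + b' *\<^sub>R j" using up[of \<gamma> j] bg by auto
  obtain e f where i: "0 \<le> e" "0 \<le> f" "i = e *\<^sub>R h0 \<beta> + f *\<^sub>R h0 \<gamma>"
    using down[OF bi] by blast
  obtain e' f' where j: "0 \<le> e'" "0 \<le> f'" "j = e' *\<^sub>R h0 \<beta> + f' *\<^sub>R h0 \<gamma>"
    using down[OF bj] by blast
  \<comment> \<open>Comparing coordinates says that the two coefficient matrices are inverse to each
    other.\<close>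
  have eqs: "1 = e * a + f * a'" "0 = e * b + f * b'" "0 = e' * a + f' * a'" "1 = e' * b + f' * b'"
  proof -
    have "c i i = e * a + f * a'"
      by (subst (2) i(3)) (simp add: \<mu>(3) \<nu>(3) c_simps c_D ij)
    moreover have "c j i = e * b + f * b'"
      by (subst i(3)) (simp add: \<mu>(3) \<nu>(3) c_simps c_D ij ij(3)[symmetric])
    moreover have "c i j = e' * a + f' * a'"
      by (subst j(3)) (simp add: \<mu>(3) \<nu>(3) c_simps c_D ij)
    moreover have "c j j = e' * b + f' * b'"
      by (subst (2) j(3)) (simp add: \<mu>(3) \<nu>(3) c_simps c_D ij ij(3)[symmetric])
    ultimately show "1 = e * a + f * a'" "0 = e * b + f * b'" "0 = e' * a + f' * a'" "1 = e' * b + f' * b'"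
      using ij by (simp_all add: c_D)
  qed
  have nn: "0 \<le> e * a" "0 \<le> f * a'" "0 \<le> e * b" "0 \<le> f * b'" "0 \<le> e' * a" "0 \<le> f' * a'" "0 \<le> e' * b" "0 \<le> f' * b'"
    using \<mu>(1,2) \<nu>(1,2) i(1,2) j(1,2) by auto
  have z: "e * b = 0" "f * b' = 0" "e' * a = 0" "f' * a' = 0" using eqs nn by linarith+
  have "a = 0 \<or> b = 0"
  proof (rule ccontr)
    assume "\<not> (a = 0 \<or> b = 0)"
    then have "e = 0" "e' = 0" using z by auto
    then have "f * a' = 1" "f' * b' = 1" using eqs by auto
    then show False using z(2) by auto
  qed
  moreover have "h0 \<beta> \<in> \<Phi>" using weyl_root h0 bg pos_root by blast
  ultimately have "h0 \<beta> = i \<or> h0 \<beta> = j"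
    using \<mu> reduced[OF ij(1), of a] reduced[OF ij(2), of b] by auto
  then show ?thesis by (simp add: h0_def)
qed

section \<open>Small roots, regions and confluence\<close>

lemma small_sub: "small \<subseteq> pos"
  by (auto simp: small_def)

lemma not_small_comb:
  assumes "\<beta> \<in> pos" "\<gamma> \<in> pos - small" "0 \<le> a" "1 \<le> b" "a *\<^sub>R \<beta> + b *\<^sub>R \<gamma> \<in> pos"
  shows "a *\<^sub>R \<beta> + b *\<^sub>R \<gamma> \<notin> small"
proof -
  have "c i \<delta> \<le> c i (a *\<^sub>R \<beta> + b *\<^sub>R \<gamma>)" if i: "i \<in> D" for i
  proof -
    have "c i \<delta> \<le> c i \<gamma>" "0 \<le> c i \<beta>" "0 \<le> c i \<gamma>" using assms i by (auto simp: small_def pos_def not_less)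
    moreover have "c i \<gamma> \<le> b * c i \<gamma>" using \<open>0 \<le> c i \<gamma>\<close> assms(4) by (simp add: mult_le_cancel_right1)
    ultimately show ?thesis using assms(3) i by (simp add: c_simps add_increasing)
  qed
  then show ?thesis by (auto simp: small_def not_less)
qed

text \<open>A region is encoded by its signs on the small roots; \<open>shi_region_eq_cell\<close>
  later links this to connected components.\<close>

definition same_region :: "('v \<Rightarrow> 'v) \<Rightarrow> ('v \<Rightarrow> 'v) \<Rightarrow> bool" where
  "same_region g h \<longleftrightarrow> inversions g \<inter> small = inversions h \<inter> small"

definition locally_minimal :: "('v \<Rightarrow> 'v) \<Rightarrow> bool" where
  "locally_minimal h \<longleftrightarrow> (\<forall>i\<in>D. \<forall>\<beta>\<in>pos. h \<beta> = - i \<longrightarrow> \<beta> \<in> small)"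

text \<open>The confluence step: inside the region and above \<open>w\<close>, a downward step
  across a non-small wall stays above \<open>w\<close>. If \<gamma> were an inversion of
  \<open>w\<close>, one could take a wall \<gamma>' leading towards \<open>w\<close>, descend around
  the face of both walls while staying above \<open>w\<close>, and find \<gamma> no longer inverted
  at the bottom. The induction on the number of inversions justifies the steps of that descent after
  the first.\<close>

lemma descent_not_inversion:
  assumes w: "w \<in> weyl" "locally_minimal w"
  shows "v \<in> weyl \<Longrightarrow> inversions w \<subseteq> inversions v \<Longrightarrow> same_region v w \<Longrightarrow> i \<in> D \<Longrightarrow>
    \<gamma> \<in> pos - small \<Longrightarrow> v \<gamma> = - i \<Longrightarrow> \<gamma> \<notin> inversions w"
proof (induction "card (inversions v)" arbitrary: v i \<gamma> rule: less_induct)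
  case less
  note v = less.prems
  show ?case
  proof
    assume gw: "\<gamma> \<in> inversions w"
    have "v \<noteq> w" using w v by (auto simp: locally_minimal_def)
    obtain j \<gamma>' where s: "j \<in> D" "\<gamma>' \<in> pos" "v \<gamma>' = j \<and> w \<gamma>' \<notin> pos \<or> v \<gamma>' = - j \<and> w \<gamma>' \<in> pos"
      by (rule exists_separating_wall[OF v(1) w(1) \<open>v \<noteq> w\<close>])
    have g': "v \<gamma>' = - j" "\<gamma>' \<in> inversions v" "\<gamma>' \<notin> inversions w"
      using s v(2) D_pos uminus_simple_notin_pos by (auto simp: inversions_iff inversions_def)
    have g'n: "\<gamma>' \<in> pos - small" using g' s v(3) by (auto simp: same_region_def)
    have ij: "i \<noteq> j"
    proof
      assume "i = j"
      then have "v \<gamma> = v \<gamma>'" using v(6) g'(1) by simp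
      then show False using weyl_inj[OF v(1)] gw g'(3) by blast
    qed
    define T where "T xs \<longleftrightarrow> set xs \<subseteq> {i, j} \<and> inversions w \<subseteq> inversions (word xs \<circ> v)
      \<and> same_region (word xs \<circ> v) w" for xs
    have Tstep: "T (k # xs) \<and> inversions (word (k # xs) \<circ> v) = inversions (word xs \<circ> v) - {\<psi>}"
      if "T xs" "k \<in> {i, j}" "\<psi> \<in> pos - small" "\<psi> \<notin> inversions w" "word xs (v \<psi>) = - k" for xs k \<psi>
    proof -
      have xsD: "set xs \<subseteq> D" using that(1) v(4) s(1) unfolding T_def by blast
      have k: "k \<in> D" using that(2) v(4) s(1) by blast
      have e: "inversions (word (k # xs) \<circ> v) = inversions (word xs \<circ> v) - {\<psi>}"
        using inversions_descent(1)[OF weyl_comp[OF word_weyl[OF xsD] v(1)] k, of \<psi>] that(3,5)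
        by (simp only: word_simps comp_assoc comp_apply) simp
      have "set (k # xs) \<subseteq> {i, j}" using that(1,2) by (simp add: T_def)
      moreover have "inversions w \<subseteq> inversions (word (k # xs) \<circ> v)"
        using that(1,4) unfolding e T_def by blast
      moreover have "same_region (word (k # xs) \<circ> v) w"
        using that(1,3) unfolding e T_def same_region_def by blast
      ultimately show ?thesis using e unfolding T_def by blast
    qed
    have "T []" using v by (simp add: T_def)
    then have T1: "T [j]" "inversions (word [j] \<circ> v) = inversions v - {\<gamma>'}"
      using Tstep[of "[]" j \<gamma>'] g' g'n by simp_all
    have T2: "card (inversions (word [j] \<circ> v)) < card (inversions v)"
      unfolding T1(2) using finite_inversions[OF v(1)] g'(2) by (rule card_Diff1_less)
    obtain xs where xs: "T xs" "\<And>ys. T ys \<Longrightarrow> card (inversions (word xs \<circ> v)) \<le> card (inversions (word ys \<circ> v))"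
      using ex_has_least_nat[of T "[j]" "\<lambda>xs. card (inversions (word xs \<circ> v))"] T1(1) by blast
    have lt: "card (inversions (word xs \<circ> v)) < card (inversions v)"
      using xs(2)[OF T1(1)] T2 by (rule le_less_trans)
    have xsD: "set xs \<subseteq> {i, j}" "set xs \<subseteq> D" using xs(1) v(4) s(1) unfolding T_def by blast+
    have wl: "word xs \<circ> v \<in> weyl" by (rule weyl_comp[OF word_weyl[OF xsD(2)] v(1)])
    have nd: "word xs (v \<psi>) \<noteq> - k" if p: "\<psi> \<in> pos" "k \<in> {i, j}" for \<psi> k
    proof
      assume e: "word xs (v \<psi>) = - k"
      have k: "k \<in> D" using p v s by auto
      have "word (k # xs) (v \<psi>) = k"
        using e k by (simp add: linear_neg[OF linear_reflect] reflect_self D_root)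
      then have "word (k # xs) (v \<psi>) \<in> pos" "word xs (v \<psi>) \<notin> pos"
        using D_pos[OF k] uminus_simple_notin_pos[OF k] e by metis+
      moreover have "set (k # xs) \<subseteq> {i, j}" using p(2) xsD(1) by simp
      \<comment> \<open>\<open>word xs\<close> and \<open>word (k # xs)\<close> give \<psi> opposite
        signs, so one of them disagrees with \<open>v\<close>.\<close>
      ultimately obtain ys where ys: "set ys \<subseteq> {i, j}" "(v \<psi> \<in> pos) \<noteq> (word ys (v \<psi>) \<in> pos)"
        using xsD(1) by metis
      obtain a b where ab: "\<psi> = a *\<^sub>R \<gamma> + b *\<^sub>R \<gamma>'" "0 \<le> a" "0 \<le> b" "a \<in> \<int>" "b \<in> \<int>"
        by (rule rank2_sign_change[OF v(1,4) s(1) ij DiffD1[OF v(5)] s(2) v(6) g'(1) ys(1) p(1) ys(2)])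
      \<comment> \<open>Both \<gamma> and \<gamma>' are non-small, so it is enough that one of the
        integers \<open>a\<close> and \<open>b\<close> is at least 1.\<close>
      have "\<psi> \<notin> small"
      proof (cases "1 \<le> b")
        case True
        then show ?thesis using not_small_comb[of \<gamma> \<gamma>' a b] g'n ab v(5) p(1) by auto
      next
        case False
        then have "b = 0" using Ints_nonneg_cases ab by blast
        then have "a \<noteq> 0" using ab(1) root_nonzero[OF pos_root[OF p(1)]] by auto
        then have "1 \<le> a" using Ints_nonneg_cases ab by blast
        then show ?thesis using not_small_comb[of \<gamma>' \<gamma> b a] g'n ab v(5) p(1) by (auto simp: add.commute)
      qed
      then have ps: "\<psi> \<in> pos - small" using p by auto
      \<comment> \<open>The chamber reached by \<open>xs\<close> has fewer inversions than
        \<open>v\<close>, so the induction hypothesis covers its descent \<psi>.\<close>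
      have "\<psi> \<notin> inversions w"
        using less.hyps[OF lt wl _ _ k ps] xs(1) e by (simp add: T_def)
      from Tstep[OF xs(1) p(2) ps this e] have t: "T (k # xs)"
        "inversions (word (k # xs) \<circ> v) = inversions (word xs \<circ> v) - {\<psi>}" by auto
      have "\<psi> \<in> inversions (word xs \<circ> v)"
        using e p k uminus_simple_notin_pos by (simp add: inversions_def)
      with finite_inversions[OF wl] have "card (inversions (word (k # xs) \<circ> v)) < card (inversions (word xs \<circ> v))"
        unfolding t(2) by (rule card_Diff1_less)
      then show False using xs(2)[OF t(1)] by simp
    qed
    have "word xs (v \<gamma>) = i \<or> word xs (v \<gamma>) = j"
      using rank2_bottom[OF v(1,4) s(1) ij DiffD1[OF v(5)] s(2) v(6) g'(1) xsD(1)] nd by blast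
    then have "\<gamma> \<notin> inversions (word xs \<circ> v)" using D_pos v(4) s(1) by (auto simp: inversions_def)
    then show False using xs(1) gw unfolding T_def by blast
  qed
qed

section \<open>Galleries inside a region\<close>

lemma card_sym_diff_less:
  assumes "finite A" "finite C" "x \<in> A \<longleftrightarrow> x \<notin> C"
    "A' = (if x \<in> A then A - {x} else insert x A)"
  shows "card ((A' - C) \<union> (C - A')) < card ((A - C) \<union> (C - A))"
proof -
  have e: "(A' - C) \<union> (C - A') = (A - C) \<union> (C - A) - {x}" using assms(3,4) by (auto split: if_splits)
  show ?thesis unfolding e
    by (rule card_Diff1_less) (use assms(1,2,3) in auto)
qed

text \<open>The symmetric difference of the inversion sets collects the hyperplanes between two
  chambers; crossing a wall of \<open>t\<close> that separates it from \<open>u\<close> removes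
  exactly that one.\<close>

lemma separating_wall_step:
  assumes "t \<in> weyl" "u \<in> weyl" "i \<in> D" "\<psi> \<in> pos"
    "t \<psi> = i \<and> u \<psi> \<notin> pos \<or> t \<psi> = - i \<and> u \<psi> \<in> pos"
  shows "inversions (reflect i \<circ> t) = (if \<psi> \<in> inversions t then inversions t - {\<psi>} else insert \<psi> (inversions t))"
    and "\<psi> \<in> inversions t \<longleftrightarrow> \<psi> \<notin> inversions u"
    and "card ((inversions (reflect i \<circ> t) - inversions u) \<union> (inversions u - inversions (reflect i \<circ> t)))
      < card ((inversions t - inversions u) \<union> (inversions u - inversions t))"
proof -
  have ni: "i \<noteq> - i" using D_pos uminus_simple_notin_pos assms(3) by force
  have t: "\<psi> \<in> inversions t \<longleftrightarrow> t \<psi> = - i"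
    using assms(3,4,5) D_pos uminus_simple_notin_pos ni by (auto simp: inversions_def)
  show 1: "inversions (reflect i \<circ> t) = (if \<psi> \<in> inversions t then inversions t - {\<psi>} else insert \<psi> (inversions t))"
  proof (cases "t \<psi> = - i")
    case True
    then show ?thesis using inversions_descent[OF assms(1,3,4)] by simp
  next
    case False
    then have "t \<psi> = i" using assms(5) by blast
    then show ?thesis using inversions_reflect[OF assms(1,3,4)] t ni by simp
  qed
  show 2: "\<psi> \<in> inversions t \<longleftrightarrow> \<psi> \<notin> inversions u"
    using t assms(5) ni unfolding inversions_iff[OF assms(4)] by metis
  show "card ((inversions (reflect i \<circ> t) - inversions u) \<union> (inversions u - inversions (reflect i \<circ> t)))
      < card ((inversions t - inversions u) \<union> (inversions u - inversions t))"
    by (rule card_sym_diff_less[OF finite_inversions[OF assms(1)] finite_inversions[OF assms(2)] 2 1])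
qed

text \<open>Among the chambers of the region above \<open>w\<close>, the one nearest to
  \<open>u\<close> is \<open>u\<close>: the next wall towards \<open>u\<close> is not small because
  both chambers share the region, and if it is crossed downwards,
  \<open>descent_not_inversion\<close> keeps the result above \<open>w\<close>.\<close>

lemma inversions_minimal:
  assumes w: "w \<in> weyl" "locally_minimal w" and u: "u \<in> weyl" "same_region u w"
  shows "inversions w \<subseteq> inversions u"
proof -
  define T where "T t \<longleftrightarrow> t \<in> weyl \<and> same_region t w \<and> inversions w \<subseteq> inversions t" for t
  define d where "d t = card ((inversions t - inversions u) \<union> (inversions u - inversions t))" for t
  have "T w" using w by (simp add: T_def same_region_def)
  then obtain t where t: "T t" "\<And>t'. T t' \<Longrightarrow> d t \<le> d t'"
    using ex_has_least_nat[of T _ d] by blast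
  have "t = u"
  proof (rule ccontr)
    assume "t \<noteq> u"
    have tw: "t \<in> weyl" using t by (simp add: T_def)
    obtain i \<psi> where s: "i \<in> D" "\<psi> \<in> pos" "t \<psi> = i \<and> u \<psi> \<notin> pos \<or> t \<psi> = - i \<and> u \<psi> \<in> pos"
      by (rule exists_separating_wall[OF tw u(1) \<open>t \<noteq> u\<close>])
    note st = separating_wall_step[OF tw u(1) s]
    have ns: "\<psi> \<in> pos - small" using st(2) t(1) u s(2) by (auto simp: T_def same_region_def)
    have "\<psi> \<notin> inversions w" if "\<psi> \<in> inversions t"
    proof -
      have "t \<psi> = - i" using that s D_pos by (auto simp: inversions_def)
      then show ?thesis using descent_not_inversion[OF w tw _ _ s(1) ns] t(1) unfolding T_def by blast
    qed
    moreover have "reflect i \<circ> t \<in> weyl" by (rule weyl_comp[OF reflect_weyl[OF s(1)] tw])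
    ultimately have "T (reflect i \<circ> t)"
      using t(1) ns unfolding T_def same_region_def st(1) by auto
    then have "d t \<le> d (reflect i \<circ> t)" by (rule t(2))
    then show False using st(3) unfolding d_def by linarith
  qed
  then show ?thesis using t by (simp add: T_def)
qed

text \<open>Take a lowest chamber of the region with descent wall \<beta>. If it is not
  \<open>w\<close>, a non-small wall \<gamma> leads down towards \<open>w\<close>. Around the face
  of \<beta> and \<gamma>, the chamber separated from the bottom one by \<beta> alone is lower, has
  the descent wall \<beta> and lies in the region, a contradiction.\<close>

lemma descent_locally_minimal:
  assumes w: "w \<in> weyl" "locally_minimal w" and u: "u \<in> weyl" "same_region u w"
    and \<beta>: "\<beta> \<in> small" "i \<in> D" "u \<beta> = - i"
  shows "\<exists>j\<in>D. w \<beta> = - j"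
proof -
  define T where "T t \<longleftrightarrow> t \<in> weyl \<and> same_region t w \<and> (\<exists>i\<in>D. t \<beta> = - i)" for t
  have bp: "\<beta> \<in> pos" using \<beta> small_sub by auto
  have "T u" using u \<beta> by (auto simp: T_def)
  then obtain t where t: "T t" "\<And>t'. T t' \<Longrightarrow> card (inversions t) \<le> card (inversions t')"
    using ex_has_least_nat[of T _ "\<lambda>t. card (inversions t)"] by blast
  then obtain i where i: "i \<in> D" "t \<beta> = - i" and tw: "t \<in> weyl" and tr: "same_region t w"
    by (auto simp: T_def)
  have "t = w"
  proof (rule ccontr)
    assume "t \<noteq> w"
    obtain j \<gamma> where s: "j \<in> D" "\<gamma> \<in> pos" "t \<gamma> = j \<and> w \<gamma> \<notin> pos \<or> t \<gamma> = - j \<and> w \<gamma> \<in> pos"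
      by (rule exists_separating_wall[OF tw w(1) \<open>t \<noteq> w\<close>])
    have g: "t \<gamma> = - j" "\<gamma> \<in> inversions t" "\<gamma> \<notin> inversions w"
      using s inversions_minimal[OF w tw tr] D_pos uminus_simple_notin_pos
      by (auto simp: inversions_def)
    have gn: "\<gamma> \<in> pos - small" using g s tr by (auto simp: same_region_def)
    have ij: "i \<noteq> j"
    proof
      assume "i = j"
      then have "t \<beta> = t \<gamma>" using i(2) g(1) by simp
      then show False using weyl_inj[OF tw] gn \<beta>(1) by blast
    qed
    define f where "f xs = card (inversions (word xs \<circ> t))" for xs
    \<comment> \<open>All chambers around the face compete here: the bottom one is itself outside
      the region, since the small root \<beta> is not inverted there.\<close>
    obtain xs where xs: "set xs \<subseteq> {i, j}" "\<And>ys. set ys \<subseteq> {i, j} \<Longrightarrow> f xs \<le> f ys"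
      using ex_has_least_nat[of "\<lambda>xs. set xs \<subseteq> {i, j}" "[]" f] by auto
    have W: "word ys \<circ> t \<in> weyl" if "set ys \<subseteq> {i, j}" for ys
    proof -
      have "set ys \<subseteq> D" using that i(1) s(1) by blast
      then show ?thesis by (rule weyl_comp[OF word_weyl tw])
    qed
    have nd: "word xs (t \<psi>) \<noteq> - k" if p: "\<psi> \<in> pos" "k \<in> {i, j}" for \<psi> k
    proof
      assume e: "word xs (t \<psi>) = - k"
      have k: "k \<in> D" using p i s by auto
      have "inversions (reflect k \<circ> (word xs \<circ> t)) = inversions (word xs \<circ> t) - {\<psi>}"
        "\<psi> \<in> inversions (word xs \<circ> t)"
        using inversions_descent[OF W[OF xs(1)] k p(1)] e by auto
      then have "f (k # xs) < f xs"
        unfolding f_def word_simps comp_assoc using finite_inversions[OF W[OF xs(1)]]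
        by (metis card_Diff1_less)
      moreover have "set (k # xs) \<subseteq> {i, j}" using p xs(1) by auto
      ultimately show False using xs(2) by (meson not_less)
    qed
    then obtain k where k: "k \<in> {i, j}" "word xs (t \<beta>) = k"
      using rank2_bottom[OF tw i(1) s(1) ij bp s(2) i(2) g(1) xs(1)] by blast
    have "word xs (t \<gamma>) \<in> {i, j}"
      using rank2_bottom[OF tw s(1) i(1) ij[symmetric] s(2) bp g(1) i(2), of xs] nd xs(1) by auto
    moreover have "\<beta> \<noteq> \<gamma>" using \<beta>(1) gn by auto
    then have "word xs (t \<gamma>) \<noteq> k" using k weyl_inj[OF W[OF xs(1)], of \<beta> \<gamma>] by auto
    ultimately have l: "word xs (t \<gamma>) \<in> D" "word xs (t \<gamma>) \<noteq> k" using i s by auto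
    have kD: "k \<in> D" using k i s by auto
    \<comment> \<open>One step up from the bottom, back across \<beta> to the side on which the
      region lies.\<close>
    define ys where "ys = k # xs"
    have ys: "set ys \<subseteq> {i, j}" using k xs by (simp add: ys_def)
    have yb: "word ys (t \<beta>) = - k" using k kD by (simp add: ys_def reflect_self D_root)
    have yg: "word ys (t \<gamma>) \<in> pos" using reflect_pos[OF kD] l D_pos by (simp add: ys_def)
    have change: "\<psi> \<in> inversions t - small" if p: "\<psi> \<in> pos" "(t \<psi> \<in> pos) \<noteq> (word ys (t \<psi>) \<in> pos)" for \<psi>
    proof -
      obtain a b where ab: "\<psi> = a *\<^sub>R \<beta> + b *\<^sub>R \<gamma>" "0 \<le> a" "0 \<le> b" "a \<in> \<int>" "b \<in> \<int>"
        using rank2_sign_change[OF tw i(1) s(1) ij bp s(2) i(2) g(1) ys p] by blast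
      have tp: "t \<psi> = (- a) *\<^sub>R i + (- b) *\<^sub>R j" using ab i g by (simp add: weyl_simps tw)
      have "t \<psi> \<notin> pos"
        unfolding tp by (rule nonpos_comb_notin_pos)
          (use tp D_pos i s ab weyl_root[OF tw pos_root[OF p(1)]] in auto)
      \<comment> \<open>For \<open>b = 0\<close> the root would be a multiple of \<beta>, which is
        negative at both chambers and so does not change sign.\<close>
      moreover have "b \<noteq> 0"
      proof
        assume "b = 0"
        then have "t \<psi> = (- a) *\<^sub>R i" "word ys (t \<psi>) = (- a) *\<^sub>R k"
          using tp ab yb weyl_simps(4)[OF W[OF ys], of a \<beta>] by auto
        moreover have "word ys (t \<psi>) \<in> pos" using p \<open>t \<psi> \<notin> pos\<close> by blast
        ultimately have "0 \<le> c k ((- a) *\<^sub>R k)" using kD by (auto simp: pos_def)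
        then have "a = 0" using ab kD by (simp add: c_simps c_D)
        then show False using \<open>b = 0\<close> ab(1) root_nonzero[OF pos_root[OF p(1)]] by simp
      qed
      then have "1 \<le> b" using Ints_nonneg_cases ab by blast
      then have "\<psi> \<notin> small" using not_small_comb[OF bp gn ab(2), of b] ab(1) p(1) by auto
      ultimately show ?thesis using p by (auto simp: inversions_def)
    qed
    have "same_region (word ys \<circ> t) w"
      using change tr unfolding same_region_def inversions_def small_def by auto
    then have "T (word ys \<circ> t)" using W[OF ys] yb kD by (auto simp: T_def)
    moreover have "inversions (word ys \<circ> t) \<subset> inversions t"
    proof
      show "inversions (word ys \<circ> t) \<subseteq> inversions t"
        using change unfolding inversions_def by auto
      show "inversions (word ys \<circ> t) \<noteq> inversions t"
        using g(2) yg unfolding inversions_def by auto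
    qed
    then have "card (inversions (word ys \<circ> t)) < card (inversions t)"
      using finite_inversions tw by (intro psubset_card_mono) auto
    ultimately show False using t(2) not_less by blast
  qed
  then show ?thesis using i by blast
qed

text \<open>Let \<open>u\<close> be the chamber of the region closest to \<open>v\<close>. Its wall
  towards \<open>v\<close> must leave the region, and \<beta> is the only small root on which the
  regions of \<open>v\<close> and \<open>w\<close> differ.\<close>

theorem descent_of_adjacent_region:
  assumes w: "w \<in> weyl" "locally_minimal w" and v: "v \<in> weyl"
    and \<beta>: "\<beta> \<in> small" "\<beta> \<in> inversions w"
    and vw: "inversions v \<inter> small = inversions w \<inter> small - {\<beta>}"
  shows "\<exists>i\<in>D. w \<beta> = - i"
proof -
  define T where "T t \<longleftrightarrow> t \<in> weyl \<and> same_region t w" for t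
  define d where "d t = card ((inversions t - inversions v) \<union> (inversions v - inversions t))" for t
  have "T w" using w by (simp add: T_def same_region_def)
  then obtain u where u: "T u" "\<And>t'. T t' \<Longrightarrow> d u \<le> d t'"
    using ex_has_least_nat[of T _ d] by blast
  have uw: "u \<in> weyl" using u by (simp add: T_def)
  have "u \<noteq> v" using u \<beta> vw by (auto simp: T_def same_region_def)
  then obtain i \<psi> where s: "i \<in> D" "\<psi> \<in> pos" "u \<psi> = i \<and> v \<psi> \<notin> pos \<or> u \<psi> = - i \<and> v \<psi> \<in> pos"
    by (rule exists_separating_wall[OF uw v])
  note st = separating_wall_step[OF uw v s]
  have "\<psi> \<in> small"
  proof (rule ccontr)
    assume "\<psi> \<notin> small"
    moreover have "reflect i \<circ> u \<in> weyl" by (rule weyl_comp[OF reflect_weyl[OF s(1)] uw])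
    ultimately have "T (reflect i \<circ> u)"
      using u(1) unfolding T_def same_region_def st(1) by auto
    then have "d u \<le> d (reflect i \<circ> u)" by (rule u(2))
    then show False using st(3) unfolding d_def by linarith
  qed
  then have "\<psi> = \<beta> \<and> \<psi> \<in> inversions u" using st(2) vw u(1) by (auto simp: T_def same_region_def)
  then have "u \<beta> = - i" using s D_pos by (auto simp: inversions_def)
  then show ?thesis
    using descent_locally_minimal[OF w uw _ \<beta>(1) s(1)] u(1) by (auto simp: T_def)
qed

end


section \<open>Affine roots as affine functions\<close>

text \<open>Reading a vector of \<open>V\<close> as an affine function absorbs the sign in
  \<open>root_hyp\<close>: the hyperplane is the zero set, and positive roots are positive on the
  fundamental alcove.\<close>

definition pair :: "'a::euclidean_space \<times> real \<Rightarrow> 'a \<Rightarrow> real" where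
  "pair v y = fst v \<bullet> y + snd v"

lemma linear_pair: "linear (\<lambda>v. pair v y)"
  by (rule linearI) (simp_all add: pair_def inner_add_left algebra_simps)

lemma pair_simps:
  "pair (u + v) y = pair u y + pair v y" "pair (- v) y = - pair v y"
  "pair (a *\<^sub>R v) y = a * pair v y"
  by (simp_all add: pair_def inner_add_left algebra_simps)

lemma pair_affine: "pair v (x + t *\<^sub>R (y - x)) = (1 - t) * pair v x + t * pair v y"
  by (simp add: pair_def inner_add_right inner_diff_right algebra_simps)

lemma root_hyp_eq: "root_hyp \<gamma> = {x. pair \<gamma> x = 0}"
  by (auto simp: root_hyp_def hyp_def pair_def inner_commute)

lemma root_hyp_inner: "root_hyp \<gamma> = {x. fst \<gamma> \<bullet> x = - snd \<gamma>}"
  by (auto simp: root_hyp_eq pair_def)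

lemma continuous_on_pair [continuous_intros]: "continuous_on S (pair v)"
  unfolding pair_def by (intro continuous_intros)

text \<open>\<open>h\<close> is the pullback of affine functions along \<open>w\<close>, that is,
  the linear action of the inverse of \<open>w\<close>; products are therefore reversed. Each of the
  two maps determines the other, as \<open>pair\<close> is non-degenerate on both sides.\<close>

definition dual :: "('a::euclidean_space \<Rightarrow> 'a) \<Rightarrow> ('a \<times> real \<Rightarrow> 'a \<times> real) \<Rightarrow> bool" where
  "dual w h \<longleftrightarrow> (\<forall>v y. pair v (w y) = pair (h v) y)"

lemma dual_id: "dual id id"
  by (simp add: dual_def)

lemma dual_comp: "dual w h \<Longrightarrow> dual w' h' \<Longrightarrow> dual (w \<circ> w') (h' \<circ> h)"
  unfolding dual_def by (metis comp_apply)

lemma pair_eqI: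
  assumes "\<And>y. pair u y = pair v y" shows "u = v"
proof -
  have s: "snd u = snd v" using assms[of 0] by (simp add: pair_def)
  then have "fst u \<bullet> y = fst v \<bullet> y" for y using assms[of y] by (simp add: pair_def)
  then have "fst u = fst v" using vector_eq_rdot by blast
  with s show ?thesis by (simp add: prod_eq_iff)
qed

lemma pair_eqI2:
  assumes "\<And>v. pair v x = pair v y" shows "x = y"
proof -
  have "z \<bullet> x = z \<bullet> y" for z using assms[of "(z, 0)"] by (simp add: pair_def)
  then show ?thesis using vector_eq_ldot by blast
qed

lemma dual_unique1: "dual w h \<Longrightarrow> dual w h' \<Longrightarrow> h = h'"
  unfolding dual_def by (metis ext pair_eqI)

lemma dual_unique2: "dual w h \<Longrightarrow> dual w' h \<Longrightarrow> w = w'"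
  unfolding dual_def by (metis ext pair_eqI2)

lemma dual_root_refl:
  assumes "fst \<gamma> \<noteq> 0" shows "dual (root_refl \<gamma>) (root_refl_V \<gamma>)"
  unfolding dual_def
proof (intro allI)
  fix v y
  have "root_refl \<gamma> (root_refl \<gamma> y) = y"
    using assms by (simp add: root_refl_def refl_aff_invol)
  then show "pair v (root_refl \<gamma> y) = pair (root_refl_V \<gamma> v) y"
    using root_refl_V_pairing[OF assms, of v "root_refl \<gamma> y"] by (simp add: pair_def)
qed

text \<open>\<open>z\<close> is the part of \<open>a'\<close> orthogonal to \<open>a\<close>. Moving
  a point of the first hyperplane by \<open>z\<close> stays in it, so \<open>a'\<close> is
  orthogonal to \<open>z\<close> and \<open>z\<close> vanishes.\<close>

lemma hyperplane_subset:
  fixes a a' :: "'a::euclidean_space"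
  assumes "a \<noteq> 0" "{x. a \<bullet> x = b} \<subseteq> {x. a' \<bullet> x = b'}"
  obtains c where "a' = c *\<^sub>R a" "b' = c * b"
proof -
  define c where "c = (a \<bullet> a') / (a \<bullet> a)"
  define p where "p = (b / (a \<bullet> a)) *\<^sub>R a"
  define z where "z = a' - c *\<^sub>R a"
  have az: "a \<bullet> z = 0" using assms(1) by (simp add: z_def c_def inner_simps)
  have "a \<bullet> p = b" "a \<bullet> (p + z) = b" using assms(1) az by (simp_all add: p_def inner_simps)
  then have "a' \<bullet> p = b'" "a' \<bullet> (p + z) = b'" using assms(2) by blast+
  then have 1: "a' \<bullet> z = 0" by (simp add: inner_simps)
  have "z \<bullet> z = a' \<bullet> z - c * (a \<bullet> z)" by (subst (1) z_def) (simp only: inner_diff_left inner_scaleR_left)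
  then have "z = 0" using 1 az by simp
  then have e: "a' = c *\<^sub>R a" by (simp add: z_def)
  moreover have "b' = c * b" using \<open>a' \<bullet> p = b'\<close> \<open>a \<bullet> p = b\<close> e by simp
  ultimately show ?thesis by (rule that)
qed

lemma dualD: "dual w h \<Longrightarrow> pair v (w y) = pair (h v) y"
  unfolding dual_def by blast

section \<open>The affine root system as an instance of the abstract setting\<close>

locale affine_root_data =
  fixes \<Phi>0 \<Delta>0 :: "'a::euclidean_space set" and \<alpha>0 :: 'a
  assumes root_system: "crystallographic_root_system \<Phi>0"
    and simple: "simple_system \<Phi>0 \<Delta>0"
    and highest: "highest_root \<Phi>0 \<Delta>0 \<alpha>0"
begin

definition aff_roots :: "('a \<times> real) set" where
  "aff_roots = {(\<alpha>, of_int k) | \<alpha> (k::int). \<alpha> \<in> \<Phi>0}"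

text \<open>Since \<open>(0, 1) = (\<alpha>0, 0) + (- \<alpha>0, 1)\<close>, these are the coordinates with respect to the
  affine simple roots.\<close>

definition coord :: "'a \<times> real \<Rightarrow> 'a \<times> real \<Rightarrow> real" where
  "coord i v = (if i = (- \<alpha>0, 1) then snd v else representation \<Delta>0 (fst v + snd v *\<^sub>R \<alpha>0) (fst i))"

text \<open>The inner product extended by zero along \<delta>; with respect to it
  \<open>root_refl_V\<close> is the orthogonal reflection, by \<open>root_refl_V_eq\<close>.\<close>

definition form :: "'a \<times> real \<Rightarrow> 'a \<times> real \<Rightarrow> real" where
  "form u v = fst u \<bullet> fst v"

lemma fin: "finite \<Phi>0" "finite \<Delta>0"
  using root_system simple finite_subset
  unfolding crystallographic_root_system_def simple_system_def by blast+

lemma root0_nonzero: "\<alpha> \<in> \<Phi>0 \<Longrightarrow> \<alpha> \<noteq> 0"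
  using root_system by (auto simp: crystallographic_root_system_def)

lemma root0_multiple: "\<alpha> \<in> \<Phi>0 \<Longrightarrow> c *\<^sub>R \<alpha> \<in> \<Phi>0 \<longleftrightarrow> c = 1 \<or> c = -1"
  using root_system by (auto simp: crystallographic_root_system_def)

lemma uminus_root0 [simp]: "- \<alpha> \<in> \<Phi>0 \<longleftrightarrow> \<alpha> \<in> \<Phi>0"
  using root0_multiple[of \<alpha> "-1"] root0_multiple[of "-\<alpha>" "-1"] by auto

lemma root0_reflect: "\<alpha> \<in> \<Phi>0 \<Longrightarrow> \<beta> \<in> \<Phi>0 \<Longrightarrow> refl_lin \<alpha> \<beta> \<in> \<Phi>0"
  using root_system unfolding crystallographic_root_system_def by blast

lemma root0_int: "\<alpha> \<in> \<Phi>0 \<Longrightarrow> \<beta> \<in> \<Phi>0 \<Longrightarrow> \<beta> \<bullet> coroot \<alpha> \<in> \<int>"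
  using root_system unfolding crystallographic_root_system_def by blast

lemma simple_sub: "\<Delta>0 \<subseteq> \<Phi>0" and simple_indep: "independent \<Delta>0" and simple_span: "span \<Delta>0 = UNIV"
  using simple root_system unfolding simple_system_def crystallographic_root_system_def by auto

lemma simple_sign: "\<alpha> \<in> \<Phi>0 \<Longrightarrow> \<alpha> \<in> nonneg_comb \<Delta>0 \<or> - \<alpha> \<in> nonneg_comb \<Delta>0"
  using simple unfolding simple_system_def by blast

lemma highest_mem: "\<alpha>0 \<in> \<Phi>0" and highest_ge: "\<beta> \<in> \<Phi>0 \<Longrightarrow> \<alpha>0 - \<beta> \<in> nonneg_comb \<Delta>0"
  using highest unfolding highest_root_def by auto

lemma rep_simps:
  "representation \<Delta>0 (x + y) \<gamma> = representation \<Delta>0 x \<gamma> + representation \<Delta>0 y \<gamma>"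
  "representation \<Delta>0 (x - y) \<gamma> = representation \<Delta>0 x \<gamma> - representation \<Delta>0 y \<gamma>"
  "representation \<Delta>0 (- x) \<gamma> = - representation \<Delta>0 x \<gamma>"
  "representation \<Delta>0 (a *\<^sub>R x) \<gamma> = a * representation \<Delta>0 x \<gamma>"
  "representation \<Delta>0 0 \<gamma> = 0"
  using simple_indep simple_span
  by (simp_all add: real_vector.representation_add real_vector.representation_diff
      real_vector.representation_neg real_vector.representation_scale real_vector.representation_zero)

lemma rep_basis: "\<beta> \<in> \<Delta>0 \<Longrightarrow> representation \<Delta>0 \<beta> \<gamma> = (if \<gamma> = \<beta> then 1 else 0)"
  using simple_indep by (simp add: real_vector.representation_basis)

lemma rep_sum: "(\<Sum>\<gamma>\<in>\<Delta>0. representation \<Delta>0 x \<gamma> *\<^sub>R \<gamma>) = x"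
  using simple_indep simple_span fin by (intro real_vector.sum_representation_eq) auto

lemma nonneg_comb_iff: "x \<in> nonneg_comb \<Delta>0 \<longleftrightarrow> (\<forall>\<gamma>\<in>\<Delta>0. 0 \<le> representation \<Delta>0 x \<gamma>)"
proof
  assume "x \<in> nonneg_comb \<Delta>0"
  then obtain d where d: "x = (\<Sum>\<alpha>\<in>\<Delta>0. d \<alpha> *\<^sub>R \<alpha>)" "\<forall>\<alpha>\<in>\<Delta>0. 0 \<le> d \<alpha>"
    by (auto simp: nonneg_comb_def)
  have "representation \<Delta>0 x \<gamma> = d \<gamma>" if "\<gamma> \<in> \<Delta>0" for \<gamma>
  proof -
    have "representation \<Delta>0 x \<gamma> = (\<Sum>\<alpha>\<in>\<Delta>0. representation \<Delta>0 (d \<alpha> *\<^sub>R \<alpha>) \<gamma>)"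
      unfolding d(1) using simple_indep simple_span by (simp add: real_vector.representation_sum)
    also have "\<dots> = (\<Sum>\<alpha>\<in>\<Delta>0. if \<alpha> = \<gamma> then d \<gamma> else 0)"
      by (rule sum.cong) (auto simp: rep_simps rep_basis)
    finally show ?thesis using that fin by simp
  qed
  then show "\<forall>\<gamma>\<in>\<Delta>0. 0 \<le> representation \<Delta>0 x \<gamma>" using d(2) by simp
next
  assume "\<forall>\<gamma>\<in>\<Delta>0. 0 \<le> representation \<Delta>0 x \<gamma>"
  then show "x \<in> nonneg_comb \<Delta>0"
    unfolding nonneg_comb_def using rep_sum[of x] by (intro CollectI exI[of _ "representation \<Delta>0 x"]) simp
qed

lemma highest_nonneg: "\<alpha>0 \<in> nonneg_comb \<Delta>0"
  using highest_ge[of "- \<alpha>0"] highest_mem by (auto simp: nonneg_comb_iff rep_simps)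

lemma nonneg_not_both:
  assumes "\<alpha> \<in> \<Phi>0" "\<alpha> \<in> nonneg_comb \<Delta>0" shows "- \<alpha> \<notin> nonneg_comb \<Delta>0"
proof
  assume "- \<alpha> \<in> nonneg_comb \<Delta>0"
  then have "\<forall>\<gamma>\<in>\<Delta>0. representation \<Delta>0 \<alpha> \<gamma> = 0"
    using assms(2) by (force simp: nonneg_comb_iff rep_simps)
  then have "\<alpha> = 0" using rep_sum[of \<alpha>] by simp
  then show False using root0_nonzero assms by blast
qed

lemma aff_root_iff: "(\<alpha>, a) \<in> aff_roots \<longleftrightarrow> \<alpha> \<in> \<Phi>0 \<and> a \<in> \<int>"
  by (auto simp: aff_roots_def elim: Ints_cases)

lemma coord_delta_node: "coord (- \<alpha>0, 1) v = snd v"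
  by (simp add: coord_def)

lemma coord_simple: "coord (\<gamma>, 0) v = representation \<Delta>0 (fst v + snd v *\<^sub>R \<alpha>0) \<gamma>"
  by (simp add: coord_def)

lemma ball_simple_roots: "(\<forall>i\<in>simple_roots \<Delta>0 \<alpha>0. P i) \<longleftrightarrow> (\<forall>\<gamma>\<in>\<Delta>0. P (\<gamma>, 0)) \<and> P (- \<alpha>0, 1)"
  by (auto simp: simple_roots_def)

lemma coord_nonneg_iff:
  "(\<forall>i\<in>simple_roots \<Delta>0 \<alpha>0. 0 \<le> coord i v) \<longleftrightarrow> 0 \<le> snd v \<and> fst v + snd v *\<^sub>R \<alpha>0 \<in> nonneg_comb \<Delta>0"
  by (auto simp: ball_simple_roots coord_delta_node coord_simple nonneg_comb_iff)

text \<open>One copy of the highest root already dominates the negative of \<beta>; the remaining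
  \<open>t - 1\<close> copies only add.\<close>

lemma nonneg_shift:
  assumes "\<beta> \<in> \<Phi>0" "1 \<le> t"
  shows "\<beta> + t *\<^sub>R \<alpha>0 \<in> nonneg_comb \<Delta>0"
proof -
  have "0 \<le> representation \<Delta>0 \<beta> \<gamma> + t * representation \<Delta>0 \<alpha>0 \<gamma>" if "\<gamma> \<in> \<Delta>0" for \<gamma>
  proof -
    have a: "0 \<le> representation \<Delta>0 \<alpha>0 \<gamma>" "0 \<le> representation \<Delta>0 \<alpha>0 \<gamma> + representation \<Delta>0 \<beta> \<gamma>"
      using highest_nonneg highest_ge[of "- \<beta>"] assms that by (auto simp: nonneg_comb_iff rep_simps)
    have "representation \<Delta>0 \<alpha>0 \<gamma> \<le> t * representation \<Delta>0 \<alpha>0 \<gamma>"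
      using a(1) assms(2) by (simp add: mult_le_cancel_right1)
    then show ?thesis using a by linarith
  qed
  then show ?thesis by (simp add: nonneg_comb_iff rep_simps)
qed

lemma pos_roots_iff:
  "(\<beta>, a) \<in> pos_roots \<Phi>0 \<Delta>0 \<longleftrightarrow> \<beta> \<in> \<Phi>0 \<and> a \<in> \<int> \<and> (1 \<le> a \<or> a = 0 \<and> \<beta> \<in> nonneg_comb \<Delta>0)"
proof
  assume "(\<beta>, a) \<in> pos_roots \<Phi>0 \<Delta>0"
  then show "\<beta> \<in> \<Phi>0 \<and> a \<in> \<int> \<and> (1 \<le> a \<or> a = 0 \<and> \<beta> \<in> nonneg_comb \<Delta>0)"
    by (auto simp: pos_roots_def fin_pos_roots_def)
next
  assume b: "\<beta> \<in> \<Phi>0 \<and> a \<in> \<int> \<and> (1 \<le> a \<or> a = 0 \<and> \<beta> \<in> nonneg_comb \<Delta>0)"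
  then obtain k where k: "a = of_int k" by (auto elim: Ints_cases)
  consider "\<beta> \<in> nonneg_comb \<Delta>0" | "1 \<le> k" "- \<beta> \<in> nonneg_comb \<Delta>0"
    using b simple_sign[of \<beta>] k by auto
  then show "(\<beta>, a) \<in> pos_roots \<Phi>0 \<Delta>0"
  proof cases
    case 1
    then show ?thesis unfolding pos_roots_def k using b k
      by (intro UnI1 CollectI exI[of _ \<beta>] exI[of _ k]) (auto simp: fin_pos_roots_def)
  next
    case 2
    then show ?thesis unfolding pos_roots_def k using b
      by (intro UnI2 CollectI exI[of _ "- \<beta>"] exI[of _ k]) (auto simp: fin_pos_roots_def)
  qed
qed

text \<open>From level 1 on, \<open>nonneg_shift\<close> makes all coordinates nonnegative; at level
  0 the shift by the highest root disappears and finite positivity remains.\<close>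

lemma pos_roots_eq:
  "pos_roots \<Phi>0 \<Delta>0 = {\<phi> \<in> aff_roots. \<forall>i\<in>simple_roots \<Delta>0 \<alpha>0. 0 \<le> coord i \<phi>}"
proof -
  have "(\<beta>, a) \<in> pos_roots \<Phi>0 \<Delta>0 \<longleftrightarrow> (\<beta>, a) \<in> aff_roots \<and> 0 \<le> a \<and> \<beta> + a *\<^sub>R \<alpha>0 \<in> nonneg_comb \<Delta>0" for \<beta> a
    unfolding pos_roots_iff aff_root_iff
    using nonneg_shift[of \<beta> a] Ints_pos_ge1[of a] by (cases "a = 0") auto
  then show ?thesis unfolding coord_nonneg_iff by auto
qed

lemma pos_roots_sign:
  assumes "\<phi> \<in> aff_roots" shows "\<phi> \<in> pos_roots \<Phi>0 \<Delta>0 \<or> - \<phi> \<in> pos_roots \<Phi>0 \<Delta>0"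
proof -
  obtain \<beta> a where \<phi>: "\<phi> = (\<beta>, a)" "\<beta> \<in> \<Phi>0" "a \<in> \<int>"
    using assms by (cases \<phi>) (auto simp: aff_root_iff)
  consider "a = 0" | "0 < a" | "0 < - a" by linarith
  then show ?thesis
    using \<phi> simple_sign[of \<beta>] Ints_pos_ge1[of a] Ints_pos_ge1[of "-a"] by cases (auto simp: pos_roots_iff)
qed

text \<open>There are finitely many finite parts, and each allows only an interval of integral
  levels. This bounds both the roots made negative by a reflection and those negative at a
  point.\<close>

lemma finite_bounded_roots: "finite {\<psi> \<in> aff_roots. 0 \<le> snd \<psi> \<and> snd \<psi> \<le> f (fst \<psi>)}"
proof -
  have "{\<psi> \<in> aff_roots. 0 \<le> snd \<psi> \<and> snd \<psi> \<le> f (fst \<psi>)}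
      \<subseteq> (\<Union>\<alpha>\<in>\<Phi>0. (\<lambda>k. (\<alpha>, of_int k)) ` {0..\<lfloor>f \<alpha>\<rfloor>})"
    by (auto simp: aff_roots_def le_floor_iff)
  then show ?thesis by (rule finite_subset) (use fin in auto)
qed

lemma root_refl_V_eq: "root_refl_V \<gamma> v = v - (2 * form \<gamma> v / form \<gamma> \<gamma>) *\<^sub>R \<gamma>"
  by (simp add: root_refl_V_def refl_aff_def coroot_def form_def prod_eq_iff inner_commute)

lemma cartan_form: "2 * form i j / form i i = fst j \<bullet> coroot (fst i)"
  by (simp add: form_def coroot_def inner_commute)

sublocale root_basis aff_roots "simple_roots \<Delta>0 \<alpha>0" coord form "(0, 1)"
proof (rule root_basis.intro)
  show "finite (simple_roots \<Delta>0 \<alpha>0)"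
    using fin by (auto simp: simple_roots_def)
  show sub: "simple_roots \<Delta>0 \<alpha>0 \<subseteq> aff_roots"
    using simple_sub highest_mem by (auto simp: simple_roots_def aff_root_iff)
  show "linear (coord i)" for i
    by (rule linearI) (auto simp: coord_def rep_simps algebra_simps)
  show "coord i j = (if i = j then 1 else 0)"
    if "i \<in> simple_roots \<Delta>0 \<alpha>0" "j \<in> simple_roots \<Delta>0 \<alpha>0" for i j
    using that by (auto simp: simple_roots_def coord_def rep_simps rep_basis split: if_splits)
  show "v = 0" if v: "\<And>i. i \<in> simple_roots \<Delta>0 \<alpha>0 \<Longrightarrow> coord i v = 0" for v
  proof -
    have "snd v = 0" using v[of "(- \<alpha>0, 1)"] by (simp add: coord_delta_node simple_roots_def)
    moreover have "representation \<Delta>0 (fst v) \<gamma> = 0" if "\<gamma> \<in> \<Delta>0" for \<gamma>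
      using \<open>snd v = 0\<close> v[of "(\<gamma>, 0)"] that by (simp add: coord_simple simple_roots_def)
    then have "fst v = 0" using rep_sum[of "fst v"] by simp
    ultimately show ?thesis by (simp add: prod_eq_iff)
  qed
  show "(\<forall>i\<in>simple_roots \<Delta>0 \<alpha>0. 0 \<le> coord i \<phi>) \<or> (\<forall>i\<in>simple_roots \<Delta>0 \<alpha>0. coord i \<phi> \<le> 0)"
    if "\<phi> \<in> aff_roots" for \<phi>
  proof -
    have "coord i (- \<phi>) = - coord i \<phi>" for i by (simp add: coord_def rep_simps)
    then show ?thesis using pos_roots_sign[OF that] by (auto simp: pos_roots_eq)
  qed
  show "a = 1 \<or> a = -1" if "i \<in> simple_roots \<Delta>0 \<alpha>0" "a *\<^sub>R i \<in> aff_roots" for i a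
  proof -
    have "fst i \<in> \<Phi>0" using that(1) sub by (cases i) (auto simp: aff_root_iff)
    moreover have "a *\<^sub>R fst i \<in> \<Phi>0" using that(2) by (cases i) (auto simp: aff_root_iff)
    ultimately show ?thesis using root0_multiple by blast
  qed
  show "bilinear form"
    unfolding bilinear_def by (intro conjI allI linearI) (simp_all add: form_def inner_simps)
  show "form u v = form v u" for u v by (simp add: form_def inner_commute)
  show fpos: "0 < form \<phi> \<phi>" if "\<phi> \<in> aff_roots" for \<phi>
    using that root0_nonzero by (cases \<phi>) (auto simp: form_def aff_root_iff)
  show "2 * form i j / form i i \<in> \<int>"
    if "i \<in> simple_roots \<Delta>0 \<alpha>0" "j \<in> simple_roots \<Delta>0 \<alpha>0" for i j
  proof -
    have "fst i \<in> \<Phi>0" "fst j \<in> \<Phi>0" using that sub by (auto simp: aff_roots_def)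
    then show ?thesis unfolding cartan_form by (rule root0_int)
  qed
  show refl: "\<psi> - (2 * form \<phi> \<psi> / form \<phi> \<phi>) *\<^sub>R \<phi> \<in> aff_roots"
    if r: "\<phi> \<in> aff_roots" "\<psi> \<in> aff_roots" for \<phi> \<psi>
  proof -
    obtain \<alpha> a \<beta> b where e: "\<phi> = (\<alpha>, a)" "\<psi> = (\<beta>, b)" "\<alpha> \<in> \<Phi>0" "\<beta> \<in> \<Phi>0" "a \<in> \<int>" "b \<in> \<int>"
      using r by (cases \<phi>, cases \<psi>) (auto simp: aff_root_iff)
    have "refl_lin \<alpha> \<beta> \<in> \<Phi>0" "\<beta> \<bullet> coroot \<alpha> \<in> \<int>" using e root0_reflect root0_int by auto
    then show ?thesis
      unfolding root_refl_V_eq[symmetric] using e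
      by (simp add: root_refl_V_def aff_root_iff inner_commute Ints_diff Ints_mult)
  qed
  show "finite {\<psi> \<in> aff_roots. (\<forall>i\<in>simple_roots \<Delta>0 \<alpha>0. 0 \<le> coord i \<psi>) \<and>
      \<not> (\<forall>i\<in>simple_roots \<Delta>0 \<alpha>0. 0 \<le> coord i (\<psi> - (2 * form \<phi> \<psi> / form \<phi> \<phi>) *\<^sub>R \<phi>))}"
    if \<phi>: "\<phi> \<in> aff_roots" for \<phi>
  \<comment> \<open>A positive root that is no longer positive after the reflection has reflected
    level at most 0, so its own level is at most this amount, which depends only on its finite
    part.\<close>
  proof (rule finite_subset[OF _ finite_bounded_roots[of "\<lambda>\<beta>. 2 * (fst \<phi> \<bullet> \<beta>) / form \<phi> \<phi> * snd \<phi>"]], rule subsetI)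
    fix \<psi>
    let ?\<psi> = "\<psi> - (2 * form \<phi> \<psi> / form \<phi> \<phi>) *\<^sub>R \<phi>"
    assume "\<psi> \<in> {\<psi> \<in> aff_roots. (\<forall>i\<in>simple_roots \<Delta>0 \<alpha>0. 0 \<le> coord i \<psi>) \<and>
      \<not> (\<forall>i\<in>simple_roots \<Delta>0 \<alpha>0. 0 \<le> coord i (\<psi> - (2 * form \<phi> \<psi> / form \<phi> \<phi>) *\<^sub>R \<phi>))}"
    then have r: "\<psi> \<in> aff_roots" and p: "\<forall>i\<in>simple_roots \<Delta>0 \<alpha>0. 0 \<le> coord i \<psi>"
      and n: "\<not> (\<forall>i\<in>simple_roots \<Delta>0 \<alpha>0. 0 \<le> coord i ?\<psi>)" by blast+
    have "0 \<le> snd \<psi>" using p by (simp add: coord_nonneg_iff)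
    moreover have "(fst ?\<psi>, snd ?\<psi>) \<notin> pos_roots \<Phi>0 \<Delta>0"
      unfolding prod.collapse using n by (auto simp: pos_roots_eq)
    moreover have "(fst ?\<psi>, snd ?\<psi>) \<in> aff_roots" unfolding prod.collapse by (rule refl[OF \<phi> r])
    ultimately have "0 \<le> snd \<psi>" "\<not> 0 < snd ?\<psi>" unfolding pos_roots_iff aff_root_iff using Ints_pos_ge1 by blast+
    then show "\<psi> \<in> {\<psi> \<in> aff_roots. 0 \<le> snd \<psi> \<and> snd \<psi> \<le> 2 * (fst \<phi> \<bullet> fst \<psi>) / form \<phi> \<phi> * snd \<phi>}"
      using r by (simp add: form_def)
  qed
  show "0 \<le> coord i (0, 1)" if "i \<in> simple_roots \<Delta>0 \<alpha>0" for i
    using that highest_nonneg by (auto simp: coord_def simple_roots_def nonneg_comb_iff)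
qed

lemma pos_eq: "pos = pos_roots \<Phi>0 \<Delta>0"
  by (simp add: pos_def pos_roots_eq)

text \<open>A positive root fails to be small when subtracting \<delta> leaves nonnegative
  coordinates. At level 2 or more \<open>nonneg_shift\<close> guarantees this, at level 1 it says
  that the finite part is positive, and at level 0 it never happens.\<close>

lemma small_eq: "small = small_roots \<Phi>0 \<Delta>0"
proof -
  have "(\<beta>, a) \<in> small \<longleftrightarrow> (\<beta>, a) \<in> small_roots \<Phi>0 \<Delta>0" for \<beta> a
  proof -
    have "(\<exists>i\<in>simple_roots \<Delta>0 \<alpha>0. coord i (\<beta>, a) < coord i (0, 1)) \<longleftrightarrow>
        \<not> (\<forall>i\<in>simple_roots \<Delta>0 \<alpha>0. 0 \<le> coord i (\<beta>, a - 1))"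
      by (auto simp: coord_def rep_simps algebra_simps not_le)
    also have "\<dots> \<longleftrightarrow> \<not> (1 \<le> a \<and> \<beta> + (a - 1) *\<^sub>R \<alpha>0 \<in> nonneg_comb \<Delta>0)"
      by (simp add: coord_nonneg_iff)
    finally have s: "(\<beta>, a) \<in> small \<longleftrightarrow> \<beta> \<in> \<Phi>0 \<and> a \<in> \<int> \<and> (1 \<le> a \<or> a = 0 \<and> \<beta> \<in> nonneg_comb \<Delta>0)
        \<and> \<not> (1 \<le> a \<and> \<beta> + (a - 1) *\<^sub>R \<alpha>0 \<in> nonneg_comb \<Delta>0)"
      by (auto simp: small_def pos_eq pos_roots_iff)
    have t: "(\<beta>, a) \<in> small_roots \<Phi>0 \<Delta>0 \<longleftrightarrow>
        \<beta> \<in> \<Phi>0 \<and> (a = 0 \<and> \<beta> \<in> nonneg_comb \<Delta>0 \<or> a = 1 \<and> - \<beta> \<in> nonneg_comb \<Delta>0)"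
    proof -
      have "(\<exists>\<alpha>. \<beta> = - \<alpha> \<and> \<alpha> \<in> \<Phi>0 \<and> \<alpha> \<in> nonneg_comb \<Delta>0) \<longleftrightarrow> \<beta> \<in> \<Phi>0 \<and> - \<beta> \<in> nonneg_comb \<Delta>0"
        by (metis minus_minus uminus_root0)
      then show ?thesis by (auto simp: small_roots_def fin_pos_roots_def)
    qed
    show ?thesis
    proof (cases "\<beta> \<in> \<Phi>0 \<and> a \<in> \<int>")
      case False
      then show ?thesis unfolding s t by auto
    next
      case True
      then have b: "\<beta> \<in> \<Phi>0" and a: "a \<in> \<int>" by auto
      consider "a \<le> 0" | "a = 1" | "2 \<le> a"
      proof -
        obtain k where "a = of_int k" using a by (rule Ints_cases)
        then show ?thesis using that by (cases "k \<le> 0"; cases "k = 1") auto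
      qed
      then show ?thesis
      proof cases
        case 3
        then show ?thesis unfolding s t using nonneg_shift[OF b, of "a - 1"] by auto
      next
        case 2
        then show ?thesis unfolding s t using b simple_sign[OF b] nonneg_not_both[OF b] by auto
      qed (auto simp: s t b)
    qed
  qed
  then show ?thesis by auto
qed


section \<open>Alcoves and Shi regions\<close>

lemma pos_fst: "\<gamma> \<in> pos \<Longrightarrow> fst \<gamma> \<noteq> 0"
  using pos_roots_fst root_system by (simp add: pos_eq)

lemma fst_aff_root: "\<phi> \<in> aff_roots \<Longrightarrow> fst \<phi> \<in> \<Phi>0"
  by (auto simp: aff_roots_def)

lemma reflect_eq: "reflect \<gamma> = root_refl_V \<gamma>"
  by (rule ext) (simp add: reflect_def root_refl_V_eq)

lemma dual_reflect: "\<gamma> \<in> pos \<Longrightarrow> dual (root_refl \<gamma>) (reflect \<gamma>)"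
  unfolding reflect_eq using dual_root_refl pos_fst by blast

section \<open>The affine Weyl group through its pullback action\<close>

lemma affine_weyl_dual:
  assumes "w \<in> affine_weyl \<Phi>0" obtains h where "h \<in> weyl" "dual w h"
proof -
  have "\<exists>h\<in>weyl. dual w h" using assms
  proof induction
    case affine_weyl_id
    have "(id :: 'a \<times> real \<Rightarrow> 'a \<times> real) \<in> weyl" using word_weyl[of "[]"] unfolding word_simps by simp
    with dual_id show ?case by (rule bexI[where x = id])
  next
    case (affine_weyl_refl \<alpha> w k)
    then obtain h where h: "h \<in> weyl" "dual w h" by blast
    obtain \<gamma> where g: "\<gamma> \<in> pos" "root_refl \<gamma> = refl_aff \<alpha> (of_int k)"
      using refl_aff_eq_root_refl[OF root_system simple affine_weyl_refl.hyps(1), of k] pos_eq by blast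
    have "dual (refl_aff \<alpha> (of_int k) \<circ> w) (h \<circ> reflect \<gamma>)"
      using dual_comp[OF dual_reflect[OF g(1)] h(2)] g(2) by simp
    then show ?case using weyl_comp[OF h(1) reflect_in_weyl[OF g(1)]] by blast
  qed
  then show ?thesis using that by blast
qed

lemma affine_weyl_comp:
  "u \<in> affine_weyl \<Phi>0 \<Longrightarrow> v \<in> affine_weyl \<Phi>0 \<Longrightarrow> u \<circ> v \<in> affine_weyl \<Phi>0"
proof (induction rule: affine_weyl.induct)
  case (affine_weyl_refl \<alpha> w k)
  have "w \<circ> v \<in> affine_weyl \<Phi>0" by (rule affine_weyl_refl.IH[OF affine_weyl_refl.prems])
  from affine_weyl.affine_weyl_refl[OF affine_weyl_refl.hyps(1) this]
  show ?case unfolding comp_assoc .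
qed simp

lemma root_refl_affine_weyl:
  assumes "\<gamma> \<in> aff_roots" shows "root_refl \<gamma> \<in> affine_weyl \<Phi>0"
proof -
  obtain \<alpha> and k :: int where g: "\<gamma> = (\<alpha>, of_int k)" "\<alpha> \<in> \<Phi>0" using assms by (auto simp: aff_roots_def)
  have "refl_aff (- \<alpha>) (of_int k) \<circ> id \<in> affine_weyl \<Phi>0"
    using g by (intro affine_weyl.intros) auto
  then show ?thesis using g by (simp add: root_refl_def)
qed

lemma simple_refls_eq: "simple_refls \<Delta>0 \<alpha>0 = root_refl ` simple_roots \<Delta>0 \<alpha>0"
proof -
  have "simple_roots \<Delta>0 \<alpha>0 = (\<lambda>\<gamma>. (\<gamma>, 0)) ` \<Delta>0 \<union> {(- \<alpha>0, 1)}"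
    by (auto simp: simple_roots_def)
  moreover have "root_refl (\<gamma>, 0) = refl_lin \<gamma>" "root_refl (- \<alpha>0, 1) = refl_aff \<alpha>0 1" for \<gamma> :: 'a
    by (simp_all add: root_refl_def refl_aff_uminus)
  ultimately show ?thesis by (simp only: simple_refls_def image_Un image_image image_insert image_empty)
qed

lemma dual_word:
  "set is \<subseteq> simple_roots \<Delta>0 \<alpha>0 \<Longrightarrow> dual (foldr (\<circ>) (map root_refl is) id) (word (rev is))"
proof (induction "is")
  case Nil
  show ?case using dual_id by (simp add: id_def)
next
  case (Cons i "is")
  have i: "i \<in> simple_roots \<Delta>0 \<alpha>0" using Cons.prems by simp
  have IH: "dual (foldr (\<circ>) (map root_refl is) id) (word (rev is))"
    by (rule Cons.IH) (use Cons.prems in simp)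
  have "dual (root_refl i \<circ> foldr (\<circ>) (map root_refl is) id) (word (rev is) \<circ> reflect i)"
    by (rule dual_comp[OF dual_reflect[OF D_pos[OF i]] IH])
  moreover have "word (rev (i # is)) = word (rev is) \<circ> reflect i" by (simp add: word_append)
  moreover have "foldr (\<circ>) (map root_refl (i # is)) id = root_refl i \<circ> foldr (\<circ>) (map root_refl is) id"
    by simp
  ultimately show ?case by (simp only:)
qed

lemma len_eq_ell:
  assumes "dual w h" shows "len \<Delta>0 \<alpha>0 w = ell h"
proof -
  have "(\<exists>ss. set ss \<subseteq> simple_refls \<Delta>0 \<alpha>0 \<and> length ss = n \<and> foldr (\<circ>) ss id = w) \<longleftrightarrow>
      (\<exists>is. set is \<subseteq> simple_roots \<Delta>0 \<alpha>0 \<and> length is = n \<and> word is = h)" (is "?L \<longleftrightarrow> ?R") for n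
  proof
    assume ?L
    then obtain ss where ss: "set ss \<subseteq> root_refl ` simple_roots \<Delta>0 \<alpha>0" "length ss = n" "foldr (\<circ>) ss id = w"
      unfolding simple_refls_eq by blast
    then have "ss \<in> lists (root_refl ` simple_roots \<Delta>0 \<alpha>0)" by auto
    then obtain "is" where i: "set is \<subseteq> simple_roots \<Delta>0 \<alpha>0" "ss = map root_refl is"
      unfolding lists_image by auto
    have "word (rev is) = h" using dual_word[OF i(1)] i(2) ss(3) assms dual_unique1 by metis
    then show ?R using i ss(2) by (intro exI[of _ "rev is"]) auto
  next
    assume ?R
    then obtain "is" where i: "set is \<subseteq> simple_roots \<Delta>0 \<alpha>0" "length is = n" "word is = h" by blast
    have "dual (foldr (\<circ>) (map root_refl (rev is)) id) h" using dual_word[of "rev is"] i by simp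
    then have "foldr (\<circ>) (map root_refl (rev is)) id = w" using assms dual_unique2 by blast
    then show ?L unfolding simple_refls_eq using i
      by (intro exI[of _ "map root_refl (rev is)"]) auto
  qed
  then show ?thesis by (simp add: len_def ell_def)
qed

text \<open>\<open>act\<close> pushes affine functions forward and \<open>h\<close> pulls them back,
  so the element of \<open>ND_R\<close> given by a simple root \<open>i\<close> is the root that
  \<open>h\<close> sends to \<open>- i\<close>.\<close>

lemma dual_act:
  assumes w: "w \<in> affine_weyl \<Phi>0" and h: "dual w h"
  shows "h (act \<Phi>0 \<Delta>0 w v) = v"
proof -
  have "\<exists>!g. acts_as \<Phi>0 \<Delta>0 w g" by (rule acts_as_total[OF root_system simple w])
  then have "acts_as \<Phi>0 \<Delta>0 w (act \<Phi>0 \<Delta>0 w)" unfolding act_def by (rule theI')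
  then have "pair (act \<Phi>0 \<Delta>0 w v) (w y) = pair v y" for y
    using acts_as_pairing[OF root_system] unfolding pair_def by blast
  then show ?thesis by (intro pair_eqI) (simp only: dualD[OF h, symmetric])
qed

lemma simple_root_of_root_refl:
  assumes i: "i \<in> simple_roots \<Delta>0 \<alpha>0" shows "simple_root_of \<Delta>0 \<alpha>0 (root_refl i) = i"
proof -
  have "root_refl i \<in> simple_refls \<Delta>0 \<alpha>0" using i by (simp add: simple_refls_eq)
  from simple_root_of_unique[OF root_system simple highest this] i
  show ?thesis unfolding simple_root_of_def by (intro the1_equality) auto
qed

lemma ND_R_eq:
  assumes w: "w \<in> affine_weyl \<Phi>0" and h: "h \<in> weyl" "dual w h"
  shows "ND_R \<Phi>0 \<Delta>0 \<alpha>0 w = {\<beta> \<in> pos. \<exists>i\<in>simple_roots \<Delta>0 \<alpha>0. h \<beta> = - i}"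
proof -
  have len: "len \<Delta>0 \<alpha>0 (w \<circ> root_refl i) = ell (reflect i \<circ> h)" if "i \<in> simple_roots \<Delta>0 \<alpha>0" for i
    by (rule len_eq_ell[OF dual_comp[OF h(2) dual_reflect[OF D_pos[OF that]]]])
  have descent: "root_refl i \<in> right_descents \<Delta>0 \<alpha>0 w \<longleftrightarrow> (\<exists>\<beta>\<in>pos. h \<beta> = - i)"
    if i: "i \<in> simple_roots \<Delta>0 \<alpha>0" for i
    using ell_descent_iff[OF h(1) i] len[OF i] len_eq_ell[OF h(2)] i
    by (auto simp: right_descents_def simple_refls_eq)
  have uniq: "- act \<Phi>0 \<Delta>0 w i = \<beta>" if "h \<beta> = - i" for i \<beta>
  proof (rule weyl_inj[OF h(1)])
    show "h (- act \<Phi>0 \<Delta>0 w i) = h \<beta>"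
      using that dual_act[OF w h(2)] by (simp only: weyl_simps(3)[OF h(1)])
  qed
  let ?I = "{i \<in> simple_roots \<Delta>0 \<alpha>0. root_refl i \<in> right_descents \<Delta>0 \<alpha>0 w}"
  have "right_descents \<Delta>0 \<alpha>0 w = root_refl ` ?I"
    unfolding right_descents_def simple_refls_eq by blast
  then have "ND_R \<Phi>0 \<Delta>0 \<alpha>0 w = (\<lambda>s. - act \<Phi>0 \<Delta>0 w (simple_root_of \<Delta>0 \<alpha>0 s)) ` root_refl ` ?I"
    unfolding ND_R_def by blast
  also have "\<dots> = (\<lambda>i. - act \<Phi>0 \<Delta>0 w i) ` ?I"
    unfolding image_image by (rule image_cong) (simp_all add: simple_root_of_root_refl)
  also have "\<dots> = {\<beta> \<in> pos. \<exists>i\<in>simple_roots \<Delta>0 \<alpha>0. h \<beta> = - i}"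
  proof (intro equalityI subsetI)
    fix \<beta> assume "\<beta> \<in> (\<lambda>i. - act \<Phi>0 \<Delta>0 w i) ` ?I"
    then obtain i where i: "i \<in> simple_roots \<Delta>0 \<alpha>0" "root_refl i \<in> right_descents \<Delta>0 \<alpha>0 w"
      "\<beta> = - act \<Phi>0 \<Delta>0 w i" by blast
    then obtain \<beta>' where "\<beta>' \<in> pos" "h \<beta>' = - i" using descent by blast
    then show "\<beta> \<in> {\<beta> \<in> pos. \<exists>i\<in>simple_roots \<Delta>0 \<alpha>0. h \<beta> = - i}"
      using i(1,3) uniq[of \<beta>' i] by auto
  next
    fix \<beta> assume "\<beta> \<in> {\<beta> \<in> pos. \<exists>i\<in>simple_roots \<Delta>0 \<alpha>0. h \<beta> = - i}"
    then obtain i where "\<beta> \<in> pos" "i \<in> simple_roots \<Delta>0 \<alpha>0" "h \<beta> = - i" by blast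
    then show "\<beta> \<in> (\<lambda>i. - act \<Phi>0 \<Delta>0 w i) ` ?I"
      using descent[of i] uniq[of \<beta> i] by (intro image_eqI[of _ _ i]) auto
  qed
  finally show ?thesis .
qed

section \<open>Signs of roots on alcoves\<close>

lemma fund_alcove_eq: "fund_alcove \<Delta>0 \<alpha>0 = {y. \<forall>i\<in>simple_roots \<Delta>0 \<alpha>0. 0 < pair i y}"
  by (auto simp: fund_alcove_def ball_simple_roots pair_def inner_commute)

lemma pos_on_alcove: "y \<in> fund_alcove \<Delta>0 \<alpha>0 \<Longrightarrow> \<psi> \<in> pos \<Longrightarrow> 0 < pair \<psi> y"
  using linear_pos[OF linear_pair] by (auto simp: fund_alcove_eq)

lemma fund_alcove_nonempty: obtains y where "y \<in> fund_alcove \<Delta>0 \<alpha>0"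
proof -
  obtain f :: "'a \<Rightarrow> real" where f: "linear f" "\<forall>\<gamma>\<in>\<Delta>0. f \<gamma> = 1"
    using linear_independent_extend[OF simple_indep, of "\<lambda>_. 1 :: real"] by blast
  \<comment> \<open>\<open>z\<close> represents \<open>f\<close>, so every simple root has value 1
    at \<open>z\<close>; the scaling below brings the value of the highest root under 1.\<close>
  define z where "z = adjoint f 1"
  have z: "x \<bullet> z = f x" for x using adjoint_works[OF f(1), of x 1] by (simp add: z_def)
  define y where "y = (1 / (1 + \<bar>f \<alpha>0\<bar>)) *\<^sub>R z"
  have "f \<alpha>0 < 1 * (1 + \<bar>f \<alpha>0\<bar>)" by (rule le_less_trans[OF abs_ge_self]) simp
  then have "f \<alpha>0 / (1 + \<bar>f \<alpha>0\<bar>) < 1" by (subst pos_divide_less_eq) auto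
  then have "y \<in> fund_alcove \<Delta>0 \<alpha>0"
    using f z by (auto simp: fund_alcove_def y_def inner_commute add_pos_nonneg)
  then show ?thesis by (rule that)
qed

text \<open>Pulled back to the fundamental alcove, \<psi> becomes \<open>h \<psi>\<close>, whose
  sign there is its sign as a root.\<close>

lemma pair_alcove_sign:
  assumes "h \<in> weyl" "dual w h" "y \<in> fund_alcove \<Delta>0 \<alpha>0" "\<psi> \<in> aff_roots"
  shows "0 < pair \<psi> (w y) \<longleftrightarrow> h \<psi> \<in> pos" "pair \<psi> (w y) < 0 \<longleftrightarrow> h \<psi> \<notin> pos"
proof -
  note e = dualD[OF assms(2), of \<psi> y]
  have "h \<psi> \<in> pos \<Longrightarrow> 0 < pair (h \<psi>) y" using pos_on_alcove assms by blast
  moreover have "0 < pair (- h \<psi>) y" if "h \<psi> \<notin> pos"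
    using pos_on_alcove[OF assms(3)] uminus_pos_iff[OF weyl_root[OF assms(1,4)]] that by blast
  ultimately show "0 < pair \<psi> (w y) \<longleftrightarrow> h \<psi> \<in> pos" "pair \<psi> (w y) < 0 \<longleftrightarrow> h \<psi> \<notin> pos"
    unfolding e pair_simps(2) by force+
qed

text \<open>Empty when \<open>x\<close> lies on a Shi hyperplane, so \<open>x \<in> cell x\<close>
  is how later lemmas say that \<open>x\<close> is off the arrangement.\<close>

definition cell :: "'a \<Rightarrow> 'a set" where
  "cell x = {y. \<forall>\<beta>\<in>small. 0 < pair \<beta> x * pair \<beta> y}"

lemma finite_small: "finite small"
proof -
  have "small \<subseteq> \<Phi>0 \<times> {0, 1}" by (auto simp: small_eq small_roots_def fin_pos_roots_def)
  then show ?thesis by (rule finite_subset) (use fin in auto)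
qed

lemma small_root: "\<beta> \<in> small \<Longrightarrow> \<beta> \<in> aff_roots"
  using small_sub pos_root by blast

lemma convex_mult_pos:
  fixes c :: real
  assumes "0 < c * a" "0 \<le> c * b" "0 \<le> t" "t < 1"
  shows "0 < c * ((1 - t) * a + t * b)"
proof -
  have "0 < (1 - t) * (c * a)" "0 \<le> t * (c * b)" using assms by auto
  then show ?thesis by (simp add: algebra_simps)
qed

lemma cell_line:
  assumes "y \<in> cell x" "\<And>\<beta>. \<beta> \<in> small \<Longrightarrow> 0 \<le> pair \<beta> x * pair \<beta> z" "0 \<le> t" "t < 1"
  shows "y + t *\<^sub>R (z - y) \<in> cell x"
  unfolding cell_def mem_Collect_eq pair_affine
proof
  fix \<beta> assume b: "\<beta> \<in> small"
  then have "0 < pair \<beta> x * pair \<beta> y" using assms(1) unfolding cell_def by blast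
  then show "0 < pair \<beta> x * ((1 - t) * pair \<beta> y + t * pair \<beta> z)"
    using assms(2)[OF b] assms(3,4) by (rule convex_mult_pos)
qed

lemma convex_cell: "convex (cell x)"
proof (rule convexI)
  fix y z
  show "u *\<^sub>R y + v *\<^sub>R z \<in> cell x"
    if a: "y \<in> cell x" "z \<in> cell x" "0 \<le> u" "0 \<le> v" "u + v = 1" for u v :: real
  proof (cases "v = 1")
    case True
    then show ?thesis using a by simp
  next
    case False
    have u: "u = 1 - v" using a by simp
    have e: "u *\<^sub>R y + v *\<^sub>R z = y + v *\<^sub>R (z - y)" by (simp add: u algebra_simps)
    show ?thesis unfolding e
      by (rule cell_line) (use a False in \<open>auto simp: cell_def less_imp_le simp del: split_paired_All\<close>)
  qed
qed

lemma open_cell: "open (cell x)"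
proof -
  have "cell x = (\<Inter>\<beta>\<in>small. {y. 0 < pair \<beta> x * pair \<beta> y})" by (auto simp: cell_def)
  then show ?thesis
    using finite_small by (auto intro!: open_INT open_Collect_less continuous_intros)
qed

text \<open>A point satisfying the weak inequalities is the limit of the segment from
  \<open>x\<close> to it, on which the strict ones hold before the endpoint.\<close>

lemma closure_cell:
  assumes "x \<in> cell x"
  shows "closure (cell x) = {y. \<forall>\<beta>\<in>small. 0 \<le> pair \<beta> x * pair \<beta> y}" (is "_ = ?C")
proof
  have "?C = (\<Inter>\<beta>\<in>small. {y. 0 \<le> pair \<beta> x * pair \<beta> y})" by auto
  also have "closed \<dots>" by (intro closed_INT ballI closed_Collect_le continuous_intros)
  finally show "closure (cell x) \<subseteq> ?C"
    by (intro closure_minimal) (auto simp: cell_def less_imp_le)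
  show "?C \<subseteq> closure (cell x)"
  proof
    fix y assume y: "y \<in> ?C"
    have "x + t *\<^sub>R (y - x) \<in> cell x" if "0 \<le> t" "t < 1" for t
      by (rule cell_line) (use y assms that in auto)
    then have "\<forall>n. x + (1 - inverse (real (Suc n))) *\<^sub>R (y - x) \<in> cell x"
      by (auto simp: inverse_le_1_iff)
    moreover have "(\<lambda>n. x + (1 - inverse (real (Suc n))) *\<^sub>R (y - x)) \<longlonglongrightarrow> x + (1 - 0) *\<^sub>R (y - x)"
      by (intro tendsto_intros LIMSEQ_inverse_real_of_nat)
    then have "(\<lambda>n. x + (1 - inverse (real (Suc n))) *\<^sub>R (y - x)) \<longlonglongrightarrow> y" by simp
    ultimately show "y \<in> closure (cell x)" unfolding closure_sequential
      by (intro exI[of _ "\<lambda>n. x + (1 - inverse (real (Suc n))) *\<^sub>R (y - x)"] conjI)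
  qed
qed

text \<open>The cell is connected and avoids the hyperplanes, so the component meeting it contains
  it; by the intermediate value theorem no small root changes sign on a component.\<close>

lemma shi_region_eq_cell:
  assumes R: "R \<in> shi_regions \<Phi>0 \<Delta>0" and x: "x \<in> R"
  shows "R = cell x" "x \<in> cell x"
proof -
  let ?U = "UNIV - (\<Union>\<beta>\<in>small. root_hyp \<beta>)"
  have R': "R \<in> components ?U" using R by (simp add: shi_regions_def small_eq)
  have nz: "pair \<beta> y \<noteq> 0" if "y \<in> R" "\<beta> \<in> small" for y \<beta>
    using in_components_subset[OF R'] that by (auto simp: root_hyp_eq)
  show xx: "x \<in> cell x" using nz[OF x] by (auto simp: cell_def zero_less_mult_iff less_le)
  have "cell x \<subseteq> R"
  proof (rule components_maximal[OF R'])
    show "connected (cell x)" using convex_cell convex_connected by blast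
    show "cell x \<subseteq> ?U" by (auto simp: cell_def root_hyp_eq)
    show "R \<inter> cell x \<noteq> {}" using x xx by auto
  qed
  moreover have "R \<subseteq> cell x"
  proof
    fix y assume y: "y \<in> R"
    have "0 < pair \<beta> x * pair \<beta> y" if b: "\<beta> \<in> small" for \<beta>
    proof (rule ccontr)
      assume "\<not> 0 < pair \<beta> x * pair \<beta> y"
      then have "pair \<beta> x \<le> 0 \<and> 0 \<le> pair \<beta> y \<or> pair \<beta> y \<le> 0 \<and> 0 \<le> pair \<beta> x"
        by (auto simp: zero_less_mult_iff not_less)
      then have "\<exists>z\<in>R. fst \<beta> \<bullet> z = - snd \<beta>"
        using connected_ivt_hyperplane[OF in_components_connected[OF R'], of x y "fst \<beta>" "- snd \<beta>"]
          connected_ivt_hyperplane[OF in_components_connected[OF R'], of y x "fst \<beta>" "- snd \<beta>"] x y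
        by (auto simp: pair_def)
      then obtain z where "z \<in> R" "pair \<beta> z = 0" by (auto simp: pair_def)
      then show False using nz b by blast
    qed
    then show "y \<in> cell x" by (simp add: cell_def)
  qed
  ultimately show "R = cell x" by auto
qed

lemma same_region_alcove_subset:
  assumes h: "h \<in> weyl" "dual w h" and h': "h' \<in> weyl" "dual w' h'"
    and y: "y \<in> fund_alcove \<Delta>0 \<alpha>0" and r: "same_region h' h"
  shows "w' ` fund_alcove \<Delta>0 \<alpha>0 \<subseteq> cell (w y)"
proof (rule image_subsetI)
  fix z assume z: "z \<in> fund_alcove \<Delta>0 \<alpha>0"
  have "0 < pair \<beta> (w y) * pair \<beta> (w' z)" if b: "\<beta> \<in> small" for \<beta>
  proof -
    have "h \<beta> \<in> pos \<longleftrightarrow> h' \<beta> \<in> pos"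
      using r b small_sub by (auto simp: same_region_def inversions_def)
    then show ?thesis
      using pair_alcove_sign[OF h y small_root[OF b]] pair_alcove_sign[OF h' z small_root[OF b]]
      by (simp add: zero_less_mult_iff)
  qed
  then show "w' z \<in> cell (w y)" by (simp add: cell_def)
qed

lemma L_Shi_locally_minimal:
  assumes w: "w \<in> L_Shi \<Phi>0 \<Delta>0 \<alpha>0" and h: "h \<in> weyl" "dual w h"
    and R: "R \<in> shi_regions \<Phi>0 \<Delta>0" "w ` fund_alcove \<Delta>0 \<alpha>0 \<subseteq> R"
  shows "locally_minimal h"
  unfolding locally_minimal_def
proof (intro ballI impI, rule ccontr)
  fix i \<beta> assume i: "i \<in> simple_roots \<Delta>0 \<alpha>0" and b: "\<beta> \<in> pos" "h \<beta> = - i" and ns: "\<beta> \<notin> small"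
  have W: "w \<in> affine_weyl \<Phi>0" using w by (simp add: L_Shi_def)
  obtain y where y: "y \<in> fund_alcove \<Delta>0 \<alpha>0" by (rule fund_alcove_nonempty)
  have R': "R = cell (w y)" using shi_region_eq_cell(1)[OF R(1), of "w y"] R(2) y by blast
  let ?u = "w \<circ> root_refl i"
  have u: "dual ?u (reflect i \<circ> h)" by (rule dual_comp[OF h(2) dual_reflect[OF D_pos[OF i]]])
  have uh: "reflect i \<circ> h \<in> weyl" by (rule weyl_comp[OF reflect_weyl[OF i] h(1)])
  have "same_region (reflect i \<circ> h) h"
    unfolding same_region_def inversions_descent(1)[OF h(1) i b] using ns by auto
  then have "?u ` fund_alcove \<Delta>0 \<alpha>0 \<subseteq> R"
    unfolding R' by (rule same_region_alcove_subset[OF h uh u y])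
  then have "shi_equiv \<Phi>0 \<Delta>0 \<alpha>0 ?u w" using R unfolding shi_equiv_def by blast
  moreover have "?u \<in> affine_weyl \<Phi>0"
    by (rule affine_weyl_comp[OF W root_refl_affine_weyl[OF D_root[OF i]]])
  ultimately have "len \<Delta>0 \<alpha>0 w \<le> len \<Delta>0 \<alpha>0 ?u" using w by (simp add: L_Shi_def)
  then show False
    using ell_descent[OF h(1) i b] by (simp add: len_eq_ell[OF h(2)] len_eq_ell[OF u])
qed

section \<open>Facets of regions and points beyond them\<close>

lemma root_hyp_subset_unique:
  assumes "\<beta> \<in> pos" "\<psi> \<in> pos" "root_hyp \<beta> \<subseteq> root_hyp \<psi>"
  shows "\<psi> = \<beta>"
proof -
  obtain c where c: "fst \<psi> = c *\<^sub>R fst \<beta>" "- snd \<psi> = c * - snd \<beta>"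
    using hyperplane_subset[OF pos_fst[OF assms(1)]] assms(3) unfolding root_hyp_inner by metis
  then have e: "\<psi> = c *\<^sub>R \<beta>" by (simp add: prod_eq_iff)
  have "fst \<psi> \<in> \<Phi>0" "fst \<beta> \<in> \<Phi>0" using assms(1,2) pos_root fst_aff_root by blast+
  then have "c = 1 \<or> c = -1" using root0_multiple c(1) by metis
  then show ?thesis using e uminus_pos_iff[OF pos_root[OF assms(1)]] assms by auto
qed

text \<open>Near \<open>m\<close> all the other inequalities stay strict, so the closure contains a
  relatively open piece of the hyperplane, which spans it affinely.\<close>

lemma facet_of_cell:
  assumes x: "x \<in> cell x" and \<beta>: "\<beta> \<in> small" and m: "pair \<beta> m = 0"
    and mx: "\<And>\<psi>. \<psi> \<in> small \<Longrightarrow> \<psi> \<noteq> \<beta> \<Longrightarrow> 0 < pair \<psi> x * pair \<psi> m"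
  shows "(closure (cell x) \<inter> root_hyp \<beta>) facet_of closure (cell x)"
    and "affine hull (closure (cell x) \<inter> root_hyp \<beta>) = root_hyp \<beta>"
proof -
  let ?C = "closure (cell x)"
  note C = closure_cell[OF x]
  define U where "U = {y. \<forall>\<psi>\<in>small - {\<beta>}. 0 < pair \<psi> x * pair \<psi> y}"
  have "U = (\<Inter>\<psi>\<in>small - {\<beta>}. {y. 0 < pair \<psi> x * pair \<psi> y})" by (auto simp: U_def)
  then have "open U" using finite_small by (auto intro!: open_INT open_Collect_less continuous_intros)
  have bn: "fst \<beta> \<noteq> 0" using \<beta> small_sub pos_fst by blast
  have aff: "affine (root_hyp \<beta>)" unfolding root_hyp_inner by (rule affine_hyperplane)
  have sub: "root_hyp \<beta> \<inter> U \<subseteq> ?C \<inter> root_hyp \<beta>"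
  proof
    fix y assume y: "y \<in> root_hyp \<beta> \<inter> U"
    have "0 \<le> pair \<psi> x * pair \<psi> y" if "\<psi> \<in> small" for \<psi>
    proof (cases "\<psi> = \<beta>")
      case True
      then show ?thesis using y by (simp add: root_hyp_eq)
    next
      case False
      then have "0 < pair \<psi> x * pair \<psi> y" using y that unfolding U_def by blast
      then show ?thesis by simp
    qed
    then show "y \<in> ?C \<inter> root_hyp \<beta>" using y unfolding C by blast
  qed
  have "affine hull (root_hyp \<beta> \<inter> U) = root_hyp \<beta>"
  proof -
    have "m \<in> root_hyp \<beta> \<inter> interior U"
      unfolding interior_open[OF \<open>open U\<close>] using m mx by (simp add: U_def root_hyp_eq)
    then have "root_hyp \<beta> \<inter> interior U \<noteq> {}" by blast
    then show ?thesis
      using affine_hull_affine_Int_nonempty_interior[OF aff] hull_same[of affine "root_hyp \<beta>"] aff by simp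
  qed
  then show hull: "affine hull (?C \<inter> root_hyp \<beta>) = root_hyp \<beta>"
    using hull_mono[OF sub, of affine] aff by (metis Int_lower2 hull_minimal subset_antisym)
  \<comment> \<open>The factor \<open>pair \<beta> x\<close> orients the supporting inequality
    correctly on whichever side \<open>x\<close> lies.\<close>
  have "(?C \<inter> {y. (- pair \<beta> x *\<^sub>R fst \<beta>) \<bullet> y = pair \<beta> x * snd \<beta>}) face_of ?C"
  proof (rule face_of_Int_supporting_hyperplane_le)
    show "convex ?C" by (intro convex_closure convex_cell)
    fix y assume "y \<in> ?C"
    then have "0 \<le> pair \<beta> x * pair \<beta> y" using C \<beta> by auto
    then show "(- pair \<beta> x *\<^sub>R fst \<beta>) \<bullet> y \<le> pair \<beta> x * snd \<beta>"
      by (simp add: pair_def algebra_simps)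
  qed
  moreover have "{y. (- pair \<beta> x *\<^sub>R fst \<beta>) \<bullet> y = pair \<beta> x * snd \<beta>} = root_hyp \<beta>"
  proof -
    have "pair \<beta> x \<noteq> 0" using x \<beta> by (auto simp: cell_def)
    moreover have "(- pair \<beta> x *\<^sub>R fst \<beta>) \<bullet> y = pair \<beta> x * snd \<beta> \<longleftrightarrow> pair \<beta> x * pair \<beta> y = 0" for y
      by (auto simp: pair_def algebra_simps add_eq_0_iff)
    ultimately show ?thesis by (auto simp: root_hyp_eq)
  qed
  ultimately have face: "(?C \<inter> root_hyp \<beta>) face_of ?C" by simp
  have "m \<in> root_hyp \<beta> \<inter> U" using m mx by (auto simp: U_def root_hyp_eq)
  then have "?C \<inter> root_hyp \<beta> \<noteq> {}" using sub by blast
  moreover have "aff_dim (?C \<inter> root_hyp \<beta>) = int DIM('a) - 1"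
    by (subst aff_dim_affine_hull[symmetric], subst hull) (simp add: root_hyp_inner aff_dim_hyperplane bn)
  moreover have "aff_dim ?C = int DIM('a)"
    using aff_dim_open[OF open_cell, of x] x closure_same_affine_hull aff_dim_affine_hull
    by (metis empty_iff)
  ultimately show "(?C \<inter> root_hyp \<beta>) facet_of ?C" using face by (simp add: facet_of_def)
qed

lemma exists_generic_point:
  assumes "open V" "V \<noteq> {}"
  obtains y where "y \<in> V" "\<And>\<phi>. \<phi> \<in> aff_roots \<Longrightarrow> pair \<phi> y \<noteq> 0"
proof -
  have "aff_roots = (\<lambda>(\<alpha>, k). (\<alpha>, real_of_int k)) ` (\<Phi>0 \<times> UNIV)"
    by (auto simp: aff_roots_def)
  then have "countable aff_roots" using fin by (auto intro: countable_finite)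
  moreover have "negligible (root_hyp \<phi>)" if "\<phi> \<in> aff_roots" for \<phi>
  proof -
    have "fst \<phi> \<noteq> 0" using that root0_nonzero fst_aff_root by blast
    then show ?thesis unfolding root_hyp_inner by (intro negligible_hyperplane) auto
  qed
  ultimately have "negligible (\<Union>\<phi>\<in>aff_roots. root_hyp \<phi>)"
    by (intro negligible_countable_Union) auto
  moreover have "\<not> negligible V" using assms open_not_negligible by blast
  ultimately have "\<not> V \<subseteq> (\<Union>\<phi>\<in>aff_roots. root_hyp \<phi>)" using negligible_subset by blast
  then show ?thesis using that by (auto simp: root_hyp_eq)
qed

text \<open>Evaluation at \<open>y\<close> is a functional that vanishes on no root and is negative
  on finitely many positive ones, so \<open>functional_chamber\<close> applies.\<close>

lemma generic_point_chamber:
  assumes "\<And>\<phi>. \<phi> \<in> aff_roots \<Longrightarrow> pair \<phi> y \<noteq> 0"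
  obtains v where "v \<in> weyl" "inversions v = {\<psi> \<in> pos. pair \<psi> y < 0}"
proof -
  have "finite {\<psi> \<in> pos. pair \<psi> y < 0}"
  proof (rule finite_subset[OF _ finite_bounded_roots[of "\<lambda>\<beta>. - (\<beta> \<bullet> y)"]])
    show "{\<psi> \<in> pos. pair \<psi> y < 0} \<subseteq> {\<psi> \<in> aff_roots. 0 \<le> snd \<psi> \<and> snd \<psi> \<le> - (fst \<psi> \<bullet> y)}"
      by (auto simp: pos_def coord_nonneg_iff pair_def)
  qed
  then obtain g where g: "g \<in> weyl" "\<And>\<psi>. \<psi> \<in> pos \<Longrightarrow> 0 < pair (g \<psi>) y"
    using functional_chamber[OF linear_pair, of y] assms by blast
  obtain v where v: "v \<in> weyl" "g \<circ> v = id" using weyl_inverse[OF g(1)] by metis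
  have gv: "g (v \<psi>) = \<psi>" for \<psi> using v(2) by (metis comp_apply id_apply)
  have "v \<psi> \<notin> pos \<longleftrightarrow> pair \<psi> y < 0" if p: "\<psi> \<in> pos" for \<psi>
  proof (cases "v \<psi> \<in> pos")
    case True
    then show ?thesis using g(2)[OF True] by (simp add: gv)
  next
    case False
    then have "- v \<psi> \<in> pos" using uminus_pos_iff weyl_root[OF v(1) pos_root[OF p]] by blast
    from g(2)[OF this] False show ?thesis by (simp add: weyl_simps g(1) gv pair_simps)
  qed
  then have "inversions v = {\<psi> \<in> pos. pair \<psi> y < 0}" by (auto simp: inversions_def)
  with v(1) show ?thesis by (rule that)
qed

text \<open>At a relative interior point of the facet no other small root vanishes: it would vanish
  on all of \<open>F\<close>, hence on the whole hyperplane of \<beta>. A short move along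
  \<open>fst \<beta>\<close> thus crosses \<beta> alone, and a perturbation then avoids every root
  hyperplane.\<close>

lemma cell_facet_neighbour:
  assumes x: "x \<in> cell x" and \<beta>: "\<beta> \<in> small" "pair \<beta> x < 0"
    and F: "F facet_of closure (cell x)" "affine hull F = root_hyp \<beta>"
  obtains y where "0 < pair \<beta> y" "\<forall>\<psi>\<in>small - {\<beta>}. 0 < pair \<psi> x * pair \<psi> y"
    "\<forall>\<phi>\<in>aff_roots. pair \<phi> y \<noteq> 0"
proof -
  have Fc: "convex F" "F \<noteq> {}" "F \<subseteq> closure (cell x)"
    using F(1) by (auto simp: facet_of_def face_of_def)
  then obtain p where p: "p \<in> rel_interior F" using rel_interior_eq_empty by blast
  have FH: "F \<subseteq> root_hyp \<beta>" using F(2) hull_subset by metis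
  have pF: "p \<in> F" using p rel_interior_subset by blast
  have pp: "0 < pair \<psi> x * pair \<psi> p" if \<psi>: "\<psi> \<in> small" "\<psi> \<noteq> \<beta>" for \<psi>
  proof (rule ccontr)
    assume n: "\<not> 0 < pair \<psi> x * pair \<psi> p"
    have F0: "0 \<le> pair \<psi> x * pair \<psi> y" if "y \<in> F" for y
      using Fc(3) that \<psi>(1) closure_cell[OF x] by blast
    have x0: "pair \<psi> x \<noteq> 0" using x \<psi>(1) by (auto simp: cell_def)
    have p0: "pair \<psi> p = 0" using n F0[OF pF] x0 by (simp add: order_le_less)
    have e: "(- pair \<psi> x *\<^sub>R fst \<psi>) \<bullet> y = pair \<psi> x * snd \<psi> \<longleftrightarrow> pair \<psi> y = 0" for y
    proof -
      have "(- pair \<psi> x *\<^sub>R fst \<psi>) \<bullet> y = pair \<psi> x * snd \<psi> \<longleftrightarrow> pair \<psi> x * pair \<psi> y = 0"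
        by (auto simp: pair_def algebra_simps add_eq_0_iff)
      then show ?thesis using x0 by simp
    qed
    let ?G = "F \<inter> {y. (- pair \<psi> x *\<^sub>R fst \<psi>) \<bullet> y = pair \<psi> x * snd \<psi>}"
    have "?G face_of F"
    proof (rule face_of_Int_supporting_hyperplane_le[OF Fc(1)])
      fix y assume "y \<in> F"
      from F0[OF this] show "(- pair \<psi> x *\<^sub>R fst \<psi>) \<bullet> y \<le> pair \<psi> x * snd \<psi>"
        by (simp add: pair_def algebra_simps)
    qed
    moreover have "p \<in> ?G" using pF p0 e by blast
    ultimately have "?G = F" using face_of_disjoint_rel_interior p by blast
    then have "F \<subseteq> root_hyp \<psi>" using e by (auto simp: root_hyp_eq)
    then have "root_hyp \<beta> \<subseteq> root_hyp \<psi>"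
      unfolding F(2)[symmetric] by (rule hull_minimal) (simp add: root_hyp_inner affine_hyperplane)
    then show False using root_hyp_subset_unique \<psi> \<beta>(1) small_sub by blast
  qed
  define U where "U = {y. \<forall>\<psi>\<in>small - {\<beta>}. 0 < pair \<psi> x * pair \<psi> y}"
  have "U = (\<Inter>\<psi>\<in>small - {\<beta>}. {y. 0 < pair \<psi> x * pair \<psi> y})" by (auto simp: U_def)
  then have oU: "open U" using finite_small by (auto intro!: open_INT open_Collect_less continuous_intros)
  have "p \<in> U" using pp by (simp add: U_def)
  then obtain e where e: "0 < e" "ball p e \<subseteq> U" using oU openE by blast
  have bn: "fst \<beta> \<noteq> 0" using \<beta>(1) small_sub pos_fst by blast
  \<comment> \<open>A displacement by half the radius keeps \<open>q\<close> in the ball.\<close>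
  define q where "q = p + (e / (2 * norm (fst \<beta>))) *\<^sub>R fst \<beta>"
  have "dist p q = e / 2" using e(1) bn by (simp add: q_def dist_norm)
  then have "q \<in> U" using e by auto
  moreover have "0 < pair \<beta> q"
  proof -
    have "pair \<beta> p = 0" using pF FH by (auto simp: root_hyp_eq)
    then have "pair \<beta> q = (e / (2 * norm (fst \<beta>))) * (fst \<beta> \<bullet> fst \<beta>)"
      by (simp add: pair_def q_def inner_add_right)
    then show ?thesis using e(1) bn by simp
  qed
  moreover have "open (U \<inter> {y. 0 < pair \<beta> y})"
    by (intro open_Int oU open_Collect_less continuous_intros)
  ultimately obtain y where "y \<in> U \<inter> {y. 0 < pair \<beta> y}" "\<And>\<phi>. \<phi> \<in> aff_roots \<Longrightarrow> pair \<phi> y \<noteq> 0"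
    using exists_generic_point[of "U \<inter> {y. 0 < pair \<beta> y}"] by blast
  then have "0 < pair \<beta> y" "\<forall>\<psi>\<in>small - {\<beta>}. 0 < pair \<psi> x * pair \<psi> y"
    "\<forall>\<phi>\<in>aff_roots. pair \<phi> y \<noteq> 0"
    unfolding U_def by blast+
  then show ?thesis by (rule that)
qed

text \<open>\<open>separates\<close> permits any equation of the hyperplane, so the sign is
  recovered from the segment joining \<open>x\<close> to the alcove, which must meet the hyperplane.
  If \<open>pair \<beta> x\<close> were nonnegative, it could only do so at \<open>x\<close>, which
  lies strictly on one side.\<close>

lemma separates_negative:
  assumes "separates (root_hyp \<beta>) X (fund_alcove \<Delta>0 \<alpha>0)" "\<beta> \<in> pos" "x \<in> X"
  shows "pair \<beta> x < 0"
proof (rule ccontr)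
  assume n: "\<not> pair \<beta> x < 0"
  obtain a b where ab: "root_hyp \<beta> = {z. a \<bullet> z = b}" "\<And>z. z \<in> X \<Longrightarrow> a \<bullet> z < b"
    "\<And>z. z \<in> fund_alcove \<Delta>0 \<alpha>0 \<Longrightarrow> b < a \<bullet> z"
    using assms(1) by (auto simp: separates_def)
  obtain y where y: "y \<in> fund_alcove \<Delta>0 \<alpha>0" by (rule fund_alcove_nonempty)
  have "\<exists>z\<in>closed_segment x y. a \<bullet> z = b"
    using connected_ivt_hyperplane[OF connected_segment(1), of x x y y a b] ab(2)[OF assms(3)] ab(3)[OF y]
    by (simp add: less_imp_le)
  then obtain z where z: "z \<in> closed_segment x y" "z \<in> root_hyp \<beta>" using ab(1) by blast
  then obtain t where t: "0 \<le> t" "t \<le> 1" "z = (1 - t) *\<^sub>R x + t *\<^sub>R y"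
    by (auto simp: in_segment)
  moreover have "(1 - t) *\<^sub>R x + t *\<^sub>R y = x + t *\<^sub>R (y - x)" by (simp add: algebra_simps)
  ultimately have t: "0 \<le> t" "t \<le> 1" "x + t *\<^sub>R (y - x) \<in> root_hyp \<beta>" using z(2) by auto
  have "(1 - t) * pair \<beta> x + t * pair \<beta> y = 0" using t(3) by (simp add: root_hyp_eq pair_affine)
  moreover have "0 < pair \<beta> y" using pos_on_alcove[OF y assms(2)] .
  moreover have "0 \<le> (1 - t) * pair \<beta> x" "0 \<le> t * pair \<beta> y" using t n \<open>0 < pair \<beta> y\<close> by auto
  ultimately have "t = 0" by (metis add_nonneg_eq_0_iff mult_eq_0_iff less_irrefl)
  then have "x \<in> root_hyp \<beta>" using t(3) by simp
  then show False using ab(1) ab(2)[OF assms(3)] by auto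
qed

theorem descent_roots_eq:
  assumes w: "w \<in> L_Shi \<Phi>0 \<Delta>0 \<alpha>0"
    and R: "R \<in> shi_regions \<Phi>0 \<Delta>0" "w ` fund_alcove \<Delta>0 \<alpha>0 \<subseteq> R"
  shows "ND_R \<Phi>0 \<Delta>0 \<alpha>0 w = SigmaD \<Phi>0 \<Delta>0 \<alpha>0 R"
proof -
  have W: "w \<in> affine_weyl \<Phi>0" using w by (simp add: L_Shi_def)
  obtain h where h: "h \<in> weyl" "dual w h" using affine_weyl_dual[OF W] .
  have lm: "locally_minimal h" by (rule L_Shi_locally_minimal[OF w h R])
  obtain y where y: "y \<in> fund_alcove \<Delta>0 \<alpha>0" by (rule fund_alcove_nonempty)
  define x where "x = w y"
  have "x \<in> R" using R(2) y by (auto simp: x_def)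
  note Rc = shi_region_eq_cell[OF R(1) this]
  note sign = pair_alcove_sign[OF h y, folded x_def]
  show ?thesis unfolding ND_R_eq[OF W h]
  proof (intro equalityI subsetI)
    fix \<beta> assume "\<beta> \<in> {\<beta> \<in> pos. \<exists>i\<in>simple_roots \<Delta>0 \<alpha>0. h \<beta> = - i}"
    then obtain i where b: "\<beta> \<in> pos" "i \<in> simple_roots \<Delta>0 \<alpha>0" "h \<beta> = - i" by blast
    have bs: "\<beta> \<in> small" using lm b by (auto simp: locally_minimal_def)
    note inv = inversions_descent[OF h(1) b(2,1,3)]
    have neg: "pair \<beta> x < 0" using sign(2)[OF pos_root[OF b(1)]] inv(2) by (simp add: inversions_def)
    define x' where "x' = (w \<circ> root_refl i) y"
    have d: "dual (w \<circ> root_refl i) (reflect i \<circ> h)" by (rule dual_comp[OF h(2) dual_reflect[OF D_pos[OF b(2)]]])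
    have d': "reflect i \<circ> h \<in> weyl" by (rule weyl_comp[OF reflect_weyl[OF b(2)] h(1)])
    note sign' = pair_alcove_sign[OF d' d y, folded x'_def]
    \<comment> \<open>The midpoint of mirror images in the two alcoves sharing the wall: it lies on
      the hyperplane of \<beta>, and every other small root has equal signs at both ends, hence the
      same sign at \<open>m\<close>.\<close>
    define m where "m = x + (1 / 2) *\<^sub>R (x' - x)"
    have pm: "pair \<psi> m = (pair \<psi> x + pair \<psi> x') / 2" for \<psi>
      unfolding m_def pair_affine by simp
    have bx: "pair \<beta> x = - pair i y"
      unfolding x_def dualD[OF h(2)] b(3) by (rule pair_simps(2))
    have "reflect i (- i) = - reflect i i" by (rule linear_neg[OF linear_reflect])
    also have "\<dots> = i" using reflect_self[OF D_root[OF b(2)]] by simp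
    finally have "(reflect i \<circ> h) \<beta> = i" unfolding comp_apply b(3) .
    then have "pair \<beta> x' = pair i y" unfolding x'_def dualD[OF d] by simp
    then have "pair \<beta> m = 0" unfolding pm bx by simp
    moreover have "0 < pair \<psi> x * pair \<psi> m" if p: "\<psi> \<in> small" "\<psi> \<noteq> \<beta>" for \<psi>
    proof -
      have pp: "\<psi> \<in> pos" using p small_sub by auto
      have "\<psi> \<in> inversions (reflect i \<circ> h) \<longleftrightarrow> \<psi> \<in> inversions h" using inv(1) p by auto
      then have "h \<psi> \<in> pos \<longleftrightarrow> (reflect i \<circ> h) \<psi> \<in> pos" using pp by (simp add: inversions_def)
      then have "pair \<psi> x > 0 \<and> pair \<psi> x' > 0 \<or> pair \<psi> x < 0 \<and> pair \<psi> x' < 0"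
        using sign[OF pos_root[OF pp]] sign'[OF pos_root[OF pp]] by blast
      then show ?thesis unfolding pm by (auto simp: zero_less_mult_iff)
    qed
    ultimately have f: "(closure R \<inter> root_hyp \<beta>) facet_of closure R"
      "affine hull (closure R \<inter> root_hyp \<beta>) = root_hyp \<beta>"
      using facet_of_cell[OF Rc(2) bs] unfolding Rc(1) by blast+
    have "separates (root_hyp \<beta>) R (fund_alcove \<Delta>0 \<alpha>0)"
      unfolding separates_def
    proof (intro exI conjI ballI)
      show "fst \<beta> \<noteq> 0" using pos_fst b(1) .
      show "root_hyp \<beta> = {z. fst \<beta> \<bullet> z = - snd \<beta>}" by (rule root_hyp_inner)
      show "fst \<beta> \<bullet> z < - snd \<beta>" if "z \<in> R" for z
        using that neg bs unfolding Rc(1) cell_def by (auto simp: zero_less_mult_iff) (auto simp: pair_def)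
      show "- snd \<beta> < fst \<beta> \<bullet> z" if "z \<in> fund_alcove \<Delta>0 \<alpha>0" for z
        using pos_on_alcove[OF that b(1)] by (simp add: pair_def)
    qed
    then show "\<beta> \<in> SigmaD \<Phi>0 \<Delta>0 \<alpha>0 R"
      using f bs unfolding SigmaD_def Sigma_region_def descent_wall_def wall_def small_eq by blast
  next
    fix \<beta> assume "\<beta> \<in> SigmaD \<Phi>0 \<Delta>0 \<alpha>0 R"
    then have bs: "\<beta> \<in> small" and sep: "separates (root_hyp \<beta>) R (fund_alcove \<Delta>0 \<alpha>0)"
      and "\<exists>F. F facet_of closure R \<and> affine hull F = root_hyp \<beta>"
      unfolding SigmaD_def Sigma_region_def descent_wall_def wall_def small_eq by blast+
    then obtain F where F: "F facet_of closure R" "affine hull F = root_hyp \<beta>" by blast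
    have bp: "\<beta> \<in> pos" using bs small_sub by auto
    have neg: "pair \<beta> x < 0" using separates_negative[OF sep bp] \<open>x \<in> R\<close> .
    obtain z where z: "0 < pair \<beta> z" "\<forall>\<psi>\<in>small - {\<beta>}. 0 < pair \<psi> x * pair \<psi> z"
      "\<forall>\<phi>\<in>aff_roots. pair \<phi> z \<noteq> 0"
      by (rule cell_facet_neighbour[OF Rc(2) bs neg F[unfolded Rc(1)]])
    \<comment> \<open>The chamber of \<open>v\<close> need not be adjacent to that of
      \<open>h\<close>; only the small roots it inverts matter.\<close>
    obtain v where v: "v \<in> weyl" "inversions v = {\<psi> \<in> pos. pair \<psi> z < 0}"
      by (rule generic_point_chamber[OF z(3)[rule_format]])
    have bi: "\<beta> \<in> inversions h" using sign(2)[OF pos_root[OF bp]] neg bp by (simp add: inversions_def)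
    have "inversions v \<inter> small = inversions h \<inter> small - {\<beta>}"
    proof -
      have "\<psi> \<in> inversions v \<longleftrightarrow> \<psi> \<in> inversions h \<and> \<psi> \<noteq> \<beta>" if p: "\<psi> \<in> small" for \<psi>
      proof (cases "\<psi> = \<beta>")
        case True
        then show ?thesis using z(1) v(2) by simp
      next
        case False
        have "\<psi> \<in> pos" using p small_sub by auto
        have "0 < pair \<psi> x * pair \<psi> z" using z(2) p False by blast
        then have "pair \<psi> z < 0 \<longleftrightarrow> pair \<psi> x < 0" by (auto simp: zero_less_mult_iff)
        then show ?thesis
          using False sign(2)[OF small_root[OF p]] v(2) \<open>\<psi> \<in> pos\<close> by (simp add: inversions_def)
      qed
      then show ?thesis by blast
    qed
    from descent_of_adjacent_region[OF h(1) lm v(1) bs bi this]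
    show "\<beta> \<in> {\<beta> \<in> pos. \<exists>i\<in>simple_roots \<Delta>0 \<alpha>0. h \<beta> = - i}" using bp by blast
  qed
qed

end

theorem theorem7p1:
  fixes \<Phi>0 \<Delta>0 :: "'a::euclidean_space set"
    and \<alpha>0 :: 'a and w :: "'a \<Rightarrow> 'a" and R :: "'a set"
  assumes "crystallographic_root_system \<Phi>0"
    and "irreducible_root_system \<Phi>0"
    and "simple_system \<Phi>0 \<Delta>0"
    and "highest_root \<Phi>0 \<Delta>0 \<alpha>0"
    and "w \<in> L_Shi \<Phi>0 \<Delta>0 \<alpha>0"
    and "R \<in> shi_regions \<Phi>0 \<Delta>0"
    and "w ` fund_alcove \<Delta>0 \<alpha>0 \<subseteq> R"
  shows "ND_R \<Phi>0 \<Delta>0 \<alpha>0 w = SigmaD \<Phi>0 \<Delta>0 \<alpha>0 R"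
proof -
  interpret affine_root_data \<Phi>0 \<Delta>0 \<alpha>0
    by (rule affine_root_data.intro[OF assms(1,3,4)])
  show ?thesis by (rule descent_roots_eq[OF assms(5,6,7)])
qed

end
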